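(* Consider the learnedLLA of capacity $n$ built from black-box list labeling arrays with admissible amortized cost function $C(\cdot)$. Suppose an adversary chooses a set of at most $n$ elements, then for each element $x_i$ the predicted rank is $\tilde r_i=r_i+e_i$ where the $e_i$ are drawn independently from an (unknown) distribution $\mathcal D$ with expectation $\mu$ and variance $s^2$, and then the adversary, seeing the predicted ranks, chooses an arbitrary insertion order. Then the expected total number of element movements over the sequence of insertions is $O\left(n\cdot C((|\mu|+s^2)^2)\right)$.
   Context: Online list labeling: elements from a totally ordered universe arrive online and must be stored in sorted order in an array of $m$ slots; the slot of an element is its label. An element movement occurs each time an element is assigned a new label (including its first placement). A list labeling array (LLA) is a (possibly randomized) data structure for this problem supporting Insert$(x)$ and Init$(S')$, where Init places a set $S'$ into an empty LLA using $O(|S'|)$ movements. $C(n')$ upper bounds the amortized cost of Insert into an LLA with capacity $n'$ and $2n'$ slots. $C$ is admissible if (1) for all $i,j$ with $i<2j$, $C(i)=O(C(j))$; (2) $C(n')=\Omega(\log n')$; (3) for all $j$, $\sum_{i\ge1}C(2^{j+i})/2^i=O(C(j))$. The rank $r_i$ of $x_i$ is the number of chosen elements smaller than $x_i$. The learnedLLA (capacity $n$, a power of 2) uses $m=6n$ slots. Let $T$ be the complete binary tree over ranks $\{1,\dots,n\}$; the $i$th node at height $h$ has assigned ranks $\{2^h(i-1)+1,\dots,2^hi\}$ and assigned slots $\{6\cdot2^h(i-1)+1,\dots,6\cdot2^hi\}$. At all times a set of nodes, the actual LLAs $P_1,\dots,P_\ell$ (left to right), is maintained so that every root-to-leaf path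 contains exactly one; each is a black-box LLA on its assigned slots, and elements of $P_i$ are smaller than those of $P_j$ for $i<j$. Initially the actual LLAs are the leaves. To insert $x$: let $i_p,i_s$ be the indices of the actual LLAs containing the predecessor and successor of $x$ ($i_s=\ell$ if no successor, $i_p=1$ if no predecessor), and $i_x$ the index of the actual LLA whose assigned ranks contain $\tilde r_x$; insert into $P_i$ with $i=i_p$ if $i_p>i_x$, $i=i_s$ if $i_s<i_x$, else $i=i_x$. If $P_i$ then has density above $1/2$, let $P_p$ be its parent in $T$, let $S_p$ be the elements currently in the slots assigned to $P_p$, and call Init$(S_p)$ on a new LLA for $P_p$, which becomes an actual LLA replacing all its descendants.
   Formalization: Admissibility (3) is read with O(C(2^j)) instead of O(C(j)), which would contradict (2); predicted ranks are rounded and clamped to 1..n, C's argument is rounded up to at least 1, and black-box arrays must stay correct (at no assumed cost) above density 1/2. *)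

theory Defs
  imports "HOL-Probability.Probability" "HOL-Library.Landau_Symbols"
begin

section \<open>Black-box list labeling arrays\<close>

text \<open>
  A randomized list labeling array over the universe \<open>'a\<close> with internal states \<open>'s\<close>.
  \<open>Init B m S\<close> is a fresh array of \<open>m\<close> slots into which \<open>S\<close> has been placed; in particular
  \<open>Init B m {}\<close> is an empty array. \<open>label B s x\<close> is the slot (counted from 1) of \<open>x\<close>, and is
  \<open>None\<close> if \<open>x\<close> is not stored.
\<close>

record ('a, 's) lla =
  Init :: "nat \<Rightarrow> 'a set \<Rightarrow> 's pmf"
  Insert :: "'a \<Rightarrow> 's \<Rightarrow> 's pmf"
  label :: "'s \<Rightarrow> 'a \<Rightarrow> nat option"

definition elements :: "('a, 's) lla \<Rightarrow> 's \<Rightarrow> 'a set" where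
  "elements B s = dom (label B s)"

definition movements :: "('a \<Rightarrow> nat option) \<Rightarrow> ('a \<Rightarrow> nat option) \<Rightarrow> nat" where
  "movements f g = card {x \<in> dom g. g x \<noteq> f x}"

primrec lla_inserts :: "('a, 's) lla \<Rightarrow> 'a list \<Rightarrow> 's \<times> nat \<Rightarrow> ('s \<times> nat) pmf" where
  "lla_inserts B [] sc = return_pmf sc"
| "lla_inserts B (x # xs) sc =
     bind_pmf (Insert B x (fst sc))
       (\<lambda>s'. lla_inserts B xs (s', snd sc + movements (label B (fst sc)) (label B s')))"

text \<open>Final state and total number of movements of \<open>Init\<close> followed by a sequence of insertions.\<close>

definition lla_run :: "('a, 's) lla \<Rightarrow> nat \<Rightarrow> 'a set \<Rightarrow> 'a list \<Rightarrow> ('s \<times> nat) pmf" where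
  "lla_run B m S xs =
     bind_pmf (Init B m S) (\<lambda>s. lla_inserts B xs (s, movements Map.empty (label B s)))"

definition stores_sorted :: "nat \<Rightarrow> 'a::linorder set \<Rightarrow> ('a \<Rightarrow> nat option) \<Rightarrow> bool" where
  "stores_sorted m X f \<longleftrightarrow>
     dom f = X \<and> ran f \<subseteq> {1..m} \<and> (\<forall>x\<in>X. \<forall>y\<in>X. x < y \<longrightarrow> the (f x) < the (f y))"

definition new_elements :: "'a set \<Rightarrow> 'a list \<Rightarrow> bool" where
  "new_elements S xs \<longleftrightarrow> finite S \<and> distinct xs \<and> set xs \<inter> S = {}"

text \<open>
  Correctness is required as long as the elements fit into the slots, because the insertion that
  pushes an array of the learnedLLA above density 1/2 is still carried out by that array.
  No bound on the cost is assumed above density 1/2; see \<open>amortized_cost\<close>.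
\<close>

definition list_labeling_array :: "('a::linorder, 's) lla \<Rightarrow> bool" where
  "list_labeling_array B \<longleftrightarrow>
     (\<forall>m S xs s c. new_elements S xs \<and> card S + length xs \<le> m \<and> (s, c) \<in> set_pmf (lla_run B m S xs)
        \<longrightarrow> stores_sorted m (S \<union> set xs) (label B s))"

text \<open>
  On an array of capacity \<open>n'\<close> with \<open>2 n'\<close> slots, \<open>Init\<close> on \<open>S\<close> has cost \<open>O(card S)\<close> and every
  insertion has amortized cost \<open>C n'\<close>: the expected total cost of any sequence of operations is at
  most the sum of these costs. The sequence does not depend on the coins of the array.
  The case \<open>xs = []\<close> is the bound on \<open>Init\<close> alone. Expectations of movement counts are taken in
  \<open>ennreal\<close>, so that an infinite expectation violates the bound.
\<close>

definition amortized_cost :: "('a, 's) lla \<Rightarrow> (nat \<Rightarrow> real) \<Rightarrow> bool" where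
  "amortized_cost B C \<longleftrightarrow>
     (\<exists>c. \<forall>n'\<ge>1. \<forall>S xs. new_elements S xs \<and> card S + length xs \<le> n' \<longrightarrow>
        (\<integral>\<^sup>+ sc. of_nat (snd sc) \<partial>measure_pmf (lla_run B (2 * n') S xs))
          \<le> ennreal (c * real (card S) + C n' * real (length xs)))"

text \<open>
  \<open>C\<close> is a function of the capacity, so its value at 0 plays no role. In the third condition the
  sum starts at \<open>i = 1\<close> and is compared with \<open>C (2 ^ j)\<close>. (Compared with \<open>C j\<close> it
  would contradict the second condition.)
\<close>

definition admissible :: "(nat \<Rightarrow> real) \<Rightarrow> bool" where
  "admissible C \<longleftrightarrow>
     (\<exists>c. \<forall>i\<ge>1. \<forall>j. i < 2 * j \<longrightarrow> C i \<le> c * C j) \<and>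
     C \<in> \<Omega>(\<lambda>n'. ln (real n')) \<and>
     (\<exists>c. \<forall>j. summable (\<lambda>i. C (2 ^ (j + Suc i)) / 2 ^ Suc i) \<and>
        (\<Sum>i. C (2 ^ (j + Suc i)) / 2 ^ Suc i) \<le> c * C (2 ^ j))"

text \<open>The value of a cost function at a real argument: round up to a capacity of at least 1.\<close>

definition cost_at :: "(nat \<Rightarrow> real) \<Rightarrow> real \<Rightarrow> real" where
  "cost_at C y = C (max 1 (nat \<lceil>y\<rceil>))"


section \<open>The learnedLLA\<close>

text \<open>The node \<open>(h, i)\<close> is the \<open>i\<close>th node at height \<open>h\<close>, with \<open>i\<close> counted from 1.\<close>

type_synonym node = "nat \<times> nat"

fun ranks :: "node \<Rightarrow> nat set" where
  "ranks (h, i) = {2 ^ h * (i - 1) + 1 .. 2 ^ h * i}"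

fun slots :: "node \<Rightarrow> nat set" where
  "slots (h, i) = {6 * 2 ^ h * (i - 1) + 1 .. 6 * 2 ^ h * i}"

fun slot :: "node \<Rightarrow> nat \<Rightarrow> nat" where
  "slot (h, i) j = 6 * 2 ^ h * (i - 1) + j"

fun parent :: "node \<Rightarrow> node" where
  "parent (h, i) = (Suc h, (i + 1) div 2)"

definition left_of :: "node \<Rightarrow> node \<Rightarrow> bool" where
  "left_of u v \<longleftrightarrow> (\<forall>a\<in>ranks u. \<forall>b\<in>ranks v. a < b)"

text \<open>The actual LLAs \<open>P\<^sub>1, \<dots>, P\<^sub>\<ell>\<close> from left to right; list indices start at 0.\<close>

type_synonym 's learned = "(node \<times> 's) list"

primrec learned_empty :: "('a, 's) lla \<Rightarrow> nat \<Rightarrow> 's learned pmf" where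
  "learned_empty B 0 = return_pmf []"
| "learned_empty B (Suc k) =
     bind_pmf (learned_empty B k) (\<lambda>P.
     bind_pmf (Init B (card (slots (0, Suc k))) {}) (\<lambda>s.
     return_pmf (P @ [((0, Suc k), s)])))"

definition contents :: "('a, 's) lla \<Rightarrow> 's learned \<Rightarrow> 'a set" where
  "contents B P = (\<Union>(v, s)\<in>set P. elements B s)"

definition contents_at :: "('a, 's) lla \<Rightarrow> 's learned \<Rightarrow> node \<Rightarrow> 'a set" where
  "contents_at B P v =
     {x. \<exists>u s j. (u, s) \<in> set P \<and> label B s x = Some j \<and> slot u j \<in> slots v}"

definition index_of_element :: "('a, 's) lla \<Rightarrow> 's learned \<Rightarrow> 'a \<Rightarrow> nat" where
  "index_of_element B P x = (THE i. i < length P \<and> x \<in> elements B (snd (P ! i)))"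

definition index_of_rank :: "'s learned \<Rightarrow> nat \<Rightarrow> nat" where
  "index_of_rank P r = (THE i. i < length P \<and> r \<in> ranks (fst (P ! i)))"

definition pred_index :: "('a::linorder, 's) lla \<Rightarrow> 's learned \<Rightarrow> 'a \<Rightarrow> nat" where
  "pred_index B P x =
     (let L = {y \<in> contents B P. y < x} in if L = {} then 0 else index_of_element B P (Max L))"

definition succ_index :: "('a::linorder, 's) lla \<Rightarrow> 's learned \<Rightarrow> 'a \<Rightarrow> nat" where
  "succ_index B P x =
     (let U = {y \<in> contents B P. x < y}
      in if U = {} then length P - 1 else index_of_element B P (Min U))"

definition target :: "('a::linorder, 's) lla \<Rightarrow> 's learned \<Rightarrow> nat \<Rightarrow> 'a \<Rightarrow> nat" where
  "target B P r x =
     (let i\<^sub>p = pred_index B P x; i\<^sub>s = succ_index B P x; i\<^sub>x = index_of_rank P r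
      in if i\<^sub>p > i\<^sub>x then i\<^sub>p else if i\<^sub>s < i\<^sub>x then i\<^sub>s else i\<^sub>x)"

definition replace_descendants :: "node \<Rightarrow> 's \<Rightarrow> 's learned \<Rightarrow> 's learned" where
  "replace_descendants v t P =
     filter (\<lambda>(u, s). left_of u v) P @ [(v, t)] @ filter (\<lambda>(u, s). left_of v u) P"

definition density :: "('a, 's) lla \<Rightarrow> node \<Rightarrow> 's \<Rightarrow> real" where
  "density B v s = real (card (elements B s)) / real (card (slots v))"

text \<open>
  Insertion of \<open>x\<close> with predicted rank \<open>r\<close>, together with the number of movements. Every element
  handed to \<open>Init\<close> is counted as moved, even if it happens to return to its former slot.
  The root needs no special case: it has \<open>6 n\<close> slots and never holds more than \<open>n\<close> elements.
\<close>

definition learned_insert ::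
  "('a::linorder, 's) lla \<Rightarrow> nat \<Rightarrow> 'a \<Rightarrow> 's learned \<Rightarrow> ('s learned \<times> nat) pmf" where
  "learned_insert B r x P =
     (let i = target B P r x; v = fst (P ! i); s = snd (P ! i) in
      bind_pmf (Insert B x s) (\<lambda>s'.
        let P' = P[i := (v, s')]; d = movements (label B s) (label B s') in
        if density B v s' > 1 / 2 then
          bind_pmf (Init B (card (slots (parent v))) (contents_at B P' (parent v))) (\<lambda>t.
            return_pmf (replace_descendants (parent v) t P', d + movements Map.empty (label B t)))
        else return_pmf (P', d)))"

primrec learned_inserts ::
  "('a::linorder, 's) lla \<Rightarrow> ('a \<Rightarrow> nat) \<Rightarrow> 'a list \<Rightarrow> 's learned \<times> nat \<Rightarrow> ('s learned \<times> nat) pmf"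
where
  "learned_inserts B p [] Pc = return_pmf Pc"
| "learned_inserts B p (x # xs) Pc =
     bind_pmf (learned_insert B (p x) x (fst Pc))
       (\<lambda>Pd. learned_inserts B p xs (fst Pd, snd Pc + snd Pd))"

text \<open>
  Expected total number of movements of the learnedLLA of capacity \<open>n\<close>, over the coins of the black
  boxes only, when the elements \<open>xs\<close> are inserted in this order with predicted ranks \<open>p\<close>.
\<close>

definition learned_cost ::
  "('a::linorder, 's) lla \<Rightarrow> nat \<Rightarrow> ('a \<Rightarrow> nat) \<Rightarrow> 'a list \<Rightarrow> ennreal" where
  "learned_cost B n p xs =
     (\<integral>\<^sup>+ Pc. of_nat (snd Pc)
        \<partial>measure_pmf (bind_pmf (learned_empty B n) (\<lambda>P. learned_inserts B p xs (P, 0))))"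


section \<open>Predictions\<close>

text \<open>True ranks are counted from 0, whereas the ranks assigned to nodes start at 1.\<close>

definition rank_in :: "'a::linorder set \<Rightarrow> 'a \<Rightarrow> nat" where
  "rank_in X x = card {y \<in> X. y < x}"

definition predicted_rank :: "'a::linorder set \<Rightarrow> ('a \<Rightarrow> real) \<Rightarrow> 'a \<Rightarrow> real" where
  "predicted_rank X e = (\<lambda>x\<in>X. real (rank_in X x) + e x)"

text \<open>
  The learnedLLA looks up the nearest integer in \<open>{1..n}\<close>, since a real prediction need not lie in
  the assigned ranks of any node. This leaves predictions in \<open>{1..n}\<close> unchanged.
\<close>

definition clamp_rank :: "nat \<Rightarrow> real \<Rightarrow> nat" where
  "clamp_rank n r = max 1 (min n (nat (round r)))"

text \<open>
  An adversary for the chosen set \<open>X\<close> maps the vector of predicted ranks to an enumeration of \<open>X\<close>,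
  the insertion order. The measurability makes the expected cost meaningful; there are only finitely
  many insertion orders.
\<close>

definition adversaries :: "'a set \<Rightarrow> (('a \<Rightarrow> real) \<Rightarrow> 'a list) set" where
  "adversaries X =
     measurable (PiM X (\<lambda>_. borel)) (count_space {xs. distinct xs \<and> set xs = X})"

definition has_mean_variance :: "real measure \<Rightarrow> real \<Rightarrow> real \<Rightarrow> bool" where
  "has_mean_variance D \<mu> v \<longleftrightarrow>
     prob_space D \<and> sets D = sets borel \<and>
     integrable D (\<lambda>x. x) \<and> integrable D (\<lambda>x. x\<^sup>2) \<and>
     prob_space.expectation D (\<lambda>x. x) = \<mu> \<and> prob_space.variance D (\<lambda>x. x) = v"

end

theory Submission
  imports Defs
begin

text \<open>
  Which array receives an element depends only on the sets stored in the arrays, never on their coins.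
  So the sets evolve deterministically, every array sees an oblivious sequence of insertions, and the
  amortized bound applies to each array separately, except for its last, overflowing insertion, which
  moves at most all the elements of the array.

  When a node of height \<open>h\<close> overflows, it holds more than \<open>3 \<cdot> 2\<^sup>h\<close> elements, whose ranks
  must spread further than its \<open>2\<^sup>h\<close> assigned ranks by at least \<open>2\<^sup>h\<close> on one side; the largest
  (or smallest) of them was predicted on the wrong side and has error of order \<open>2\<^sup>h\<close>. These
  witnesses are distinct for distinct nodes of the same height. By Chebyshev the expected number of
  nodes created at height \<open>h\<close> is therefore \<open>O(n (\<mu>\<^sup>2 + s\<^sup>2) / 4\<^sup>h)\<close>. Heights with
  \<open>2\<^sup>h\<close> at most \<open>(\<bar>\<mu>\<bar> + s\<^sup>2)\<^sup>2\<close> cost \<open>C\<close> per insertion plus \<open>O(n)\<close> per level for \<open>Init\<close>,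
  which is absorbed by \<open>C = \<Omega>(log)\<close>; the larger heights are summed by the third admissibility
  condition.
\<close>

section \<open>The tree of nodes\<close>

definition nodes :: "nat \<Rightarrow> node set" where
  "nodes k = {(h, i). h \<le> k \<and> 1 \<le> i \<and> i \<le> 2 ^ (k - h)}"

lemma finite_nodes: "finite (nodes k)"
proof -
  have "nodes k \<subseteq> {..k} \<times> {..2 ^ k}"
  proof
    fix v assume "v \<in> nodes k"
    then obtain h i where v: "v = (h, i)" "h \<le> k" "i \<le> 2 ^ (k - h)"
      by (auto simp: nodes_def)
    moreover have "(2::nat) ^ (k - h) \<le> 2 ^ k"
      by (intro power_increasing) auto
    ultimately show "v \<in> {..k} \<times> {..2 ^ k}" by (auto elim: le_trans)
  qed
  then show ?thesis by (rule finite_subset) auto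
qed

lemma sum_nodes_at_height: "(\<Sum>v\<in>{v \<in> nodes k. fst v = h}. (2::real) ^ fst v) \<le> 2 ^ k"
proof (cases "h \<le> k")
  case True
  have "{v \<in> nodes k. fst v = h} = Pair h ` {1..2 ^ (k - h)}"
    using True by (auto simp: nodes_def)
  then have "card {v \<in> nodes k. fst v = h} = 2 ^ (k - h)"
    by (simp add: card_image inj_on_def)
  moreover have "(2::real) ^ (k - h) * 2 ^ h = 2 ^ k"
    using True by (simp flip: power_add)
  ultimately show ?thesis by simp
next
  case False
  then have e: "{v \<in> nodes k. fst v = h} = {}" by (auto simp: nodes_def)
  show ?thesis unfolding e by simp
qed

lemma finite_ranks [simp]: "finite (ranks v)"
  by (cases v) auto

lemma card_ranks: "v \<in> nodes k \<Longrightarrow> card (ranks v) = 2 ^ fst v"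
  by (cases v) (auto simp: nodes_def algebra_simps)

lemma ranks_nonempty: "v \<in> nodes k \<Longrightarrow> ranks v \<noteq> {}"
  using card_ranks[of v k] by auto

lemma card_slots: "v \<in> nodes k \<Longrightarrow> card (slots v) = 6 * 2 ^ fst v"
  by (cases v) (auto simp: nodes_def algebra_simps)

lemma left_of_disjoint: "left_of u v \<Longrightarrow> ranks u \<inter> ranks v = {}"
  by (fastforce simp: left_of_def)

lemma not_left_of_self: "v \<in> nodes k \<Longrightarrow> \<not> left_of v v"
  using left_of_disjoint[of v v] ranks_nonempty[of v k] by auto

lemma left_of_trans:
  assumes "left_of u v" "left_of v w" "v \<in> nodes k"
  shows "left_of u w"
proof -
  obtain r where "r \<in> ranks v" using ranks_nonempty[OF assms(3)] by blast
  then show ?thesis using assms unfolding left_of_def by (meson less_trans)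
qed

lemma left_of_subset:
  "left_of u v \<Longrightarrow> ranks u' \<subseteq> ranks u \<Longrightarrow> ranks v' \<subseteq> ranks v \<Longrightarrow> left_of u' v'"
  unfolding left_of_def by blast

lemma left_of_antisym: "left_of u v \<Longrightarrow> u \<in> nodes k \<Longrightarrow> v \<in> nodes k \<Longrightarrow> \<not> left_of v u"
  using left_of_trans not_left_of_self by blast

lemma nested_or_apart:
  assumes "u \<in> nodes k" "v \<in> nodes k" "fst u \<le> fst v"
  shows "ranks u \<subseteq> ranks v \<or> left_of u v \<or> left_of v u"
proof -
  obtain h i where u: "u = (h, i)" by (cases u)
  obtain g j where v: "v = (g, j)" by (cases v)
  obtain d where g: "g = h + d" using assms(3) u v le_Suc_ex by auto
  have ij: "1 \<le> i" "1 \<le> j" using assms u v by (auto simp: nodes_def)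
  consider "i \<le> 2 ^ d * (j - 1)" | "2 ^ d * j \<le> i - 1" | "2 ^ d * (j - 1) \<le> i - 1" "i \<le> 2 ^ d * j"
    by linarith
  then show ?thesis
  proof cases
    case 1
    then have "2 ^ h * i \<le> 2 ^ h * (2 ^ d * (j - 1))" by (rule mult_le_mono2)
    then have "2 ^ h * i \<le> 2 ^ (h + d) * (j - 1)" by (simp add: power_add mult.assoc)
    then have "left_of u v" unfolding left_of_def u v g ranks.simps atLeastAtMost_iff by force
    then show ?thesis by blast
  next
    case 2
    then have "2 ^ h * (2 ^ d * j) \<le> 2 ^ h * (i - 1)" by (rule mult_le_mono2)
    then have "2 ^ (h + d) * j \<le> 2 ^ h * (i - 1)" by (simp add: power_add mult.assoc)
    then have "left_of v u" unfolding left_of_def u v g ranks.simps atLeastAtMost_iff by force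
    then show ?thesis by blast
  next
    case 3
    have "2 ^ h * (2 ^ d * (j - 1)) \<le> 2 ^ h * (i - 1)" "2 ^ h * i \<le> 2 ^ h * (2 ^ d * j)"
      using 3 by (auto intro: mult_le_mono2)
    then have "ranks u \<subseteq> ranks v" by (auto simp: u v g power_add mult.assoc)
    then show ?thesis by blast
  qed
qed

lemma parent_in_nodes:
  assumes "v \<in> nodes k" "fst v < k"
  shows "parent v \<in> nodes k"
proof -
  obtain h i where v: "v = (h, i)" by (cases v)
  have "k - h = Suc (k - Suc h)" using assms v by auto
  then have "(2::nat) ^ (k - h) = 2 * 2 ^ (k - Suc h)" by simp
  then show ?thesis using assms by (auto simp: nodes_def v)
qed

lemma fst_parent [simp]: "fst (parent v) = Suc (fst v)"
  by (cases v) auto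

lemma ranks_parent:
  assumes "v \<in> nodes k"
  shows "ranks v \<subseteq> ranks (parent v)"
proof -
  obtain h i where v: "v = (h, i)" by (cases v)
  have "2 * ((i + 1) div 2 - 1) \<le> i - 1" "i \<le> 2 * ((i + 1) div 2)"
    using assms by (auto simp: nodes_def v)
  then have "2 ^ h * (2 * ((i + 1) div 2 - 1)) \<le> 2 ^ h * (i - 1)"
     "2 ^ h * i \<le> 2 ^ h * (2 * ((i + 1) div 2))" by (auto intro: mult_le_mono2)
  then show ?thesis by (auto simp: v mult_ac)
qed

lemma slot_rank:
  assumes "u \<in> nodes k" "j \<in> {1..6 * 2 ^ fst u}"
  shows "(slot u j - 1) div 6 + 1 \<in> ranks u"
proof -
  obtain h i where u: "u = (h, i)" "1 \<le> i" using assms by (auto simp: nodes_def)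
  have e: "(slot u j - 1) div 6 = 2 ^ h * (i - 1) + (j - 1) div 6"
  proof -
    have "slot u j - 1 = (j - 1) + 6 * (2 ^ h * (i - 1))" using assms by (auto simp: u)
    then show ?thesis by simp
  qed
  have "(j - 1) div 6 < 2 ^ h" using assms u by (auto simp: div_less_iff_less_mult)
  moreover have "2 ^ h * i = 2 ^ h * (i - 1) + 2 ^ h" using u by (simp add: algebra_simps)
  ultimately show ?thesis unfolding e by (auto simp: u)
qed

lemma slots_iff_rank:
  assumes "v \<in> nodes k" "1 \<le> a"
  shows "a \<in> slots v \<longleftrightarrow> (a - 1) div 6 + 1 \<in> ranks v"
proof -
  obtain h i where v: "v = (h, i)" by (cases v)
  have "6 * 2 ^ h * (i - 1) + 1 \<le> a \<longleftrightarrow> 2 ^ h * (i - 1) \<le> (a - 1) div 6"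
    using assms by (auto simp: less_eq_div_iff_mult_less_eq mult_ac)
  moreover have "a \<le> 6 * 2 ^ h * i \<longleftrightarrow> (a - 1) div 6 < 2 ^ h * i"
    using assms by (auto simp: div_less_iff_less_mult mult_ac)
  ultimately show ?thesis by (auto simp: v)
qed

lemma slot_in_slots_iff:
  assumes "u \<in> nodes k" "v \<in> nodes k" "j \<in> {1..6 * 2 ^ fst u}"
    and "ranks u \<subseteq> ranks v \<or> left_of u v \<or> left_of v u"
  shows "slot u j \<in> slots v \<longleftrightarrow> ranks u \<subseteq> ranks v"
proof -
  let ?r = "(slot u j - 1) div 6 + 1"
  have "1 \<le> slot u j" using assms(3) by (cases u) auto
  then have "slot u j \<in> slots v \<longleftrightarrow> ?r \<in> ranks v" using slots_iff_rank assms(2) by blast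
  moreover have "?r \<in> ranks u" using slot_rank assms by blast
  ultimately show ?thesis
    using assms(4) left_of_disjoint[of u v] left_of_disjoint[of v u] by blast
qed

definition tiling :: "nat \<Rightarrow> node list \<Rightarrow> bool" where
  "tiling k ns \<longleftrightarrow> set ns \<subseteq> nodes k \<and> sorted_wrt left_of ns \<and> {1..2 ^ k} \<subseteq> (\<Union>v\<in>set ns. ranks v)"

lemma tiling_apart:
  assumes "tiling k ns" "u \<in> set ns" "v \<in> set ns" "u \<noteq> v"
  shows "left_of u v \<or> left_of v u"
proof -
  obtain i j where "i < length ns" "u = ns ! i" "j < length ns" "v = ns ! j"
    using assms by (auto simp: in_set_conv_nth)
  moreover from this have "i < j \<or> j < i" using assms(4) by (cases i j rule: linorder_cases) auto
  ultimately show ?thesis using assms(1) by (auto simp: tiling_def sorted_wrt_iff_nth_less)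
qed

lemma tiling_distinct:
  assumes "tiling k ns"
  shows "distinct ns"
  unfolding distinct_conv_nth
proof (intro allI impI)
  fix i j assume ij: "i < length ns" "j < length ns" "i \<noteq> j"
  then have "left_of (ns ! i) (ns ! j) \<or> left_of (ns ! j) (ns ! i)"
    using assms by (cases i j rule: linorder_cases) (auto simp: tiling_def sorted_wrt_iff_nth_less)
  moreover have "\<not> left_of (ns ! i) (ns ! i)"
    using assms ij by (intro not_left_of_self[of _ k]) (auto simp: tiling_def)
  ultimately show "ns ! i \<noteq> ns ! j" by auto
qed

lemma tiling_eq:
  assumes "tiling k ns" "u \<in> set ns" "v \<in> set ns" "ranks u \<inter> ranks v \<noteq> {}"
  shows "u = v"
  using tiling_apart[OF assms(1-3)] assms(4) left_of_disjoint by blast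

definition merged :: "node \<Rightarrow> node list \<Rightarrow> node list" where
  "merged v ns = filter (\<lambda>u. left_of u v) ns @ [v] @ filter (left_of v) ns"

lemma parent_not_covered:
  assumes "tiling k ns" "v \<in> set ns" "u \<in> set ns" "fst v < k"
  shows "\<not> ranks (parent v) \<subseteq> ranks u"
proof
  assume a: "ranks (parent v) \<subseteq> ranks u"
  have v: "v \<in> nodes k" and "u \<in> nodes k" using assms by (auto simp: tiling_def)
  then have "ranks v \<subseteq> ranks u" using a ranks_parent by blast
  then have "u = v" using tiling_eq[OF assms(1), of v u] assms ranks_nonempty[OF v] by blast
  then have "card (ranks (parent v)) \<le> card (ranks v)" using a by (intro card_mono) auto
  then show False using card_ranks[OF v] card_ranks[OF parent_in_nodes[OF v assms(4)]] by simp
qed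

lemma parent_trichotomy:
  assumes "tiling k ns" "v \<in> set ns" "u \<in> set ns" "fst v < k"
  shows "ranks u \<subseteq> ranks (parent v) \<or> left_of u (parent v) \<or> left_of (parent v) u"
proof -
  have v: "v \<in> nodes k" and u: "u \<in> nodes k" using assms by (auto simp: tiling_def)
  show ?thesis
    using nested_or_apart[OF u parent_in_nodes[OF v assms(4)]]
      nested_or_apart[OF parent_in_nodes[OF v assms(4)] u] parent_not_covered[OF assms]
    by linarith
qed

lemma set_merged:
  "set (merged v ns) = insert v {u \<in> set ns. left_of u v \<or> left_of v u}"
  by (auto simp: merged_def)

lemma tiling_merged:
  assumes t: "tiling k ns" "v \<in> set ns" "fst v < k"
  shows "tiling k (merged (parent v) ns)"
  unfolding tiling_def
proof (intro conjI)
  have v: "v \<in> nodes k" using assms by (auto simp: tiling_def)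
  note pv = parent_in_nodes[OF v assms(3)]
  show "set (merged (parent v) ns) \<subseteq> nodes k"
    using t pv by (auto simp: set_merged tiling_def)
  have "sorted_wrt left_of ns" using t by (simp add: tiling_def)
  then show "sorted_wrt left_of (merged (parent v) ns)"
    using left_of_trans[OF _ _ pv] unfolding merged_def sorted_wrt_append
    by (simp add: sorted_wrt_filter ball_Un del: parent.simps)
  show "{1..2 ^ k} \<subseteq> (\<Union>v\<in>set (merged (parent v) ns). ranks v)"
  proof
    fix r assume "r \<in> {1..(2::nat) ^ k}"
    then obtain u where u: "u \<in> set ns" "r \<in> ranks u" using t(1) unfolding tiling_def by blast
    then show "r \<in> (\<Union>v\<in>set (merged (parent v) ns). ranks v)"
      using parent_trichotomy[OF t(1,2) u(1) t(3)] unfolding set_merged by blast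
  qed
qed

lemma tiling_leaves: "tiling k (map (Pair 0) [1..<Suc (2 ^ k)])"
  unfolding tiling_def
proof (intro conjI)
  show "set (map (Pair 0) [1..<Suc (2 ^ k)]) \<subseteq> nodes k" by (auto simp: nodes_def)
  show "sorted_wrt left_of (map (Pair 0) [1..<Suc (2 ^ k)])"
    unfolding sorted_wrt_map
    by (rule sorted_wrt_mono_rel[OF _ sorted_wrt_upt]) (auto simp: left_of_def)
  show "{1..2 ^ k} \<subseteq> (\<Union>v\<in>set (map (Pair 0) [1..<Suc (2 ^ k)]). ranks v)"
  proof
    fix r assume r: "r \<in> {1..(2::nat) ^ k}"
    then have "r \<in> ranks (0, r)" by simp
    moreover have "(0, r) \<in> set (map (Pair 0) [1..<Suc (2 ^ k)])" using r by auto
    ultimately show "r \<in> (\<Union>v\<in>set (map (Pair 0) [1..<Suc (2 ^ k)]). ranks v)" by blast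
  qed
qed

section \<open>The deterministic evolution of the stored sets\<close>

text \<open>
  The second inequality is strict because true ranks start at 0 but clamped predictions at 1, so that
  a difference of 1 in this direction need not come from a prediction error.
\<close>

definition far :: "('a \<Rightarrow> nat) \<Rightarrow> ('a \<Rightarrow> nat) \<Rightarrow> nat \<Rightarrow> 'a \<Rightarrow> bool" where
  "far p rk h y \<longleftrightarrow> p y + 2 ^ h \<le> rk y \<or> rk y + 2 ^ h < p y"

lemma card_le_rank_difference:
  fixes X :: "'a::linorder set"
  assumes "finite X" "E \<subseteq> X" "E \<noteq> {}"
  shows "card E + rank_in X (Min E) \<le> Suc (rank_in X (Max E))"
proof -
  have f: "finite E" using assms finite_subset by blast
  define L where "L = {y \<in> X. y < Min E}"
  have "E - {Max E} \<subseteq> {y \<in> X. y < Max E} - L"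
    using assms f by (auto simp: L_def order.not_eq_order_implies_strict)
  then have "card (E - {Max E}) \<le> card ({y \<in> X. y < Max E} - L)"
    using assms by (intro card_mono) auto
  moreover have "L \<subseteq> {y \<in> X. y < Max E}"
  proof -
    have "Min E \<le> Max E" using f assms by auto
    then show ?thesis by (auto simp: L_def)
  qed
  then have "card ({y \<in> X. y < Max E} - L) = rank_in X (Max E) - card L"
    "card L \<le> rank_in X (Max E)"
    using assms finite_subset[of L X]
    by (auto simp: card_Diff_subset rank_in_def L_def intro!: card_mono)
  moreover have "card L = rank_in X (Min E)" by (simp add: L_def rank_in_def)
  moreover have "card (E - {Max E}) = card E - 1" "card E \<noteq> 0" using f assms by auto
  ultimately show ?thesis by linarith
qed

lemma overfull_far:
  fixes X :: "'a::linorder set"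
  assumes "finite X" "E \<subseteq> X" "v \<in> nodes k" "3 * 2 ^ fst v < card E"
    and hi: "\<And>x. x \<in> E \<Longrightarrow> \<exists>y\<in>E. x \<le> y \<and> (\<exists>r\<in>ranks v. p y \<le> r)"
    and lo: "\<And>x. x \<in> E \<Longrightarrow> \<exists>y\<in>E. y \<le> x \<and> (\<exists>r\<in>ranks v. r \<le> p y)"
  shows "\<exists>y\<in>E. far p (rank_in X) (fst v) y"
proof -
  have f: "finite E" and ne: "E \<noteq> {}" using assms finite_subset by fastforce+
  obtain h i where v: "v = (h, i)" "1 \<le> i" using assms(3) by (auto simp: nodes_def)
  obtain y where "y \<in> E" "Max E \<le> y" "\<exists>r\<in>ranks v. p y \<le> r" using hi[OF Max_in[OF f ne]] by blast
  moreover from this have "y = Max E" using f by (simp add: antisym)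
  ultimately have M: "p (Max E) \<le> 2 ^ h * i" by (auto simp: v)
  obtain y where "y \<in> E" "y \<le> Min E" "\<exists>r\<in>ranks v. r \<le> p y" using lo[OF Min_in[OF f ne]] by blast
  moreover from this have "y = Min E" using f by (simp add: antisym)
  ultimately have m: "2 ^ h * (i - 1) + 1 \<le> p (Min E)" by (auto simp: v)
  have "2 ^ h * i = 2 ^ h * (i - 1) + 2 ^ h" using v by (simp add: algebra_simps)
  then have "far p (rank_in X) h (Max E) \<or> far p (rank_in X) h (Min E)"
    using M m card_le_rank_difference[OF assms(1,2) ne] assms(4) unfolding far_def v fst_conv
    by linarith
  then show ?thesis using f ne v by (auto intro: Max_in Min_in)
qed

definition fits :: "node list \<Rightarrow> (node \<Rightarrow> 'a::linorder set) \<Rightarrow> nat \<Rightarrow> 'a \<Rightarrow> node \<Rightarrow> bool" where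
  "fits ns E r x v \<longleftrightarrow> v \<in> set ns \<and>
     (\<forall>u\<in>set ns. left_of u v \<longrightarrow> (\<forall>y\<in>E u. y < x)) \<and>
     (\<forall>u\<in>set ns. left_of v u \<longrightarrow> (\<forall>y\<in>E u. x < y)) \<and>
     ((\<exists>q\<in>ranks v. r \<le> q) \<or> (\<exists>y\<in>E v. x < y)) \<and>
     ((\<exists>q\<in>ranks v. q \<le> r) \<or> (\<exists>y\<in>E v. y < x))"

definition arranged :: "nat \<Rightarrow> ('a::linorder \<Rightarrow> nat) \<Rightarrow> node list \<Rightarrow> (node \<Rightarrow> 'a set) \<Rightarrow> bool" where
  "arranged k p ns E \<longleftrightarrow> tiling k ns \<and>
     (\<forall>u\<in>set ns. \<forall>v\<in>set ns. left_of u v \<longrightarrow> (\<forall>x\<in>E u. \<forall>y\<in>E v. x < y)) \<and>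
     (\<forall>u\<in>set ns. \<forall>x\<in>E u. \<exists>y\<in>E u. x \<le> y \<and> (\<exists>r\<in>ranks u. p y \<le> r)) \<and>
     (\<forall>u\<in>set ns. \<forall>x\<in>E u. \<exists>y\<in>E u. y \<le> x \<and> (\<exists>r\<in>ranks u. r \<le> p y))"

lemma arranged_cong:
  assumes "\<And>u. u \<in> set ns \<Longrightarrow> E u = E' u"
  shows "arranged k p ns E \<longleftrightarrow> arranged k p ns E'"
  unfolding arranged_def using assms by (simp cong: ball_cong)

lemma arranged_disjoint:
  assumes "arranged k p ns E" "u \<in> set ns" "v \<in> set ns" "x \<in> E u" "x \<in> E v"
  shows "u = v"
  using tiling_apart[of k ns u v] assms unfolding arranged_def by (metis less_irrefl)

lemma arranged_insert:
  assumes a: "arranged k p ns E" and f: "fits ns E (p x) x v"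
  shows "arranged k p ns (E(v := insert x (E v)))"
proof -
  have t: "tiling k ns"
    and o: "\<And>u v x y. u \<in> set ns \<Longrightarrow> v \<in> set ns \<Longrightarrow> left_of u v \<Longrightarrow> x \<in> E u \<Longrightarrow> y \<in> E v \<Longrightarrow> x < y"
    and hi: "\<And>u x. u \<in> set ns \<Longrightarrow> x \<in> E u \<Longrightarrow> \<exists>y\<in>E u. x \<le> y \<and> (\<exists>r\<in>ranks u. p y \<le> r)"
    and lo: "\<And>u x. u \<in> set ns \<Longrightarrow> x \<in> E u \<Longrightarrow> \<exists>y\<in>E u. y \<le> x \<and> (\<exists>r\<in>ranks u. r \<le> p y)"
    using a unfolding arranged_def by blast+
  have v: "v \<in> set ns"
    and l: "\<And>u y. u \<in> set ns \<Longrightarrow> left_of u v \<Longrightarrow> y \<in> E u \<Longrightarrow> y < x"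
    and r: "\<And>u y. u \<in> set ns \<Longrightarrow> left_of v u \<Longrightarrow> y \<in> E u \<Longrightarrow> x < y"
    and nhi: "(\<exists>q\<in>ranks v. p x \<le> q) \<or> (\<exists>y\<in>E v. x < y)"
    and nlo: "(\<exists>q\<in>ranks v. q \<le> p x) \<or> (\<exists>y\<in>E v. y < x)"
    using f unfolding fits_def by blast+
  have "\<not> left_of v v" using t v not_left_of_self unfolding tiling_def by blast
  moreover have "\<exists>y\<in>insert x (E v). x \<le> y \<and> (\<exists>q\<in>ranks v. p y \<le> q)"
    using nhi hi[OF v] by (meson insertI1 insertI2 less_imp_le order.trans order_refl)
  moreover have "\<exists>y\<in>insert x (E v). y \<le> x \<and> (\<exists>q\<in>ranks v. q \<le> p y)"
    using nlo lo[OF v] by (meson insertI1 insertI2 less_imp_le order.trans order_refl)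
  ultimately show ?thesis
    unfolding arranged_def using t o l r hi lo v by (auto split: if_splits)
qed

definition below :: "node list \<Rightarrow> node \<Rightarrow> (node \<Rightarrow> 'a set) \<Rightarrow> 'a set" where
  "below ns v E = (\<Union>u\<in>{u \<in> set ns. ranks u \<subseteq> ranks v}. E u)"

lemma mem_below: "x \<in> below ns v E \<longleftrightarrow> (\<exists>u\<in>set ns. ranks u \<subseteq> ranks v \<and> x \<in> E u)"
  unfolding below_def UN_iff mem_Collect_eq Bex_def by meson

lemma below_upper: "u \<in> set ns \<Longrightarrow> ranks u \<subseteq> ranks v \<Longrightarrow> E u \<subseteq> below ns v E"
  unfolding below_def by (rule UN_upper) simp

lemma below_subset: "below ns v E \<subseteq> (\<Union>u\<in>set ns. E u)"
  unfolding below_def by (rule UN_mono) simp_all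

lemma arranged_merged:
  assumes a: "arranged k p ns E" and v: "v \<in> set ns" and h: "fst v < k"
  shows "arranged k p (merged (parent v) ns) (E(parent v := below ns (parent v) E))"
proof -
  let ?w = "parent v"
  have t: "tiling k ns"
    and o: "\<And>u v x y. u \<in> set ns \<Longrightarrow> v \<in> set ns \<Longrightarrow> left_of u v \<Longrightarrow> x \<in> E u \<Longrightarrow> y \<in> E v \<Longrightarrow> x < y"
    and hi: "\<And>u x. u \<in> set ns \<Longrightarrow> x \<in> E u \<Longrightarrow> \<exists>y\<in>E u. x \<le> y \<and> (\<exists>r\<in>ranks u. p y \<le> r)"
    and lo: "\<And>u x. u \<in> set ns \<Longrightarrow> x \<in> E u \<Longrightarrow> \<exists>y\<in>E u. y \<le> x \<and> (\<exists>r\<in>ranks u. r \<le> p y)"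
    using a unfolding arranged_def by blast+
  have "v \<in> nodes k" using t v by (auto simp: tiling_def)
  then have w: "?w \<in> nodes k" using parent_in_nodes h by blast
  define E' where "E' = E(?w := below ns ?w E)"
  have Ew: "E' ?w = below ns ?w E" and En: "\<And>u. u \<noteq> ?w \<Longrightarrow> E' u = E u"
    by (auto simp: E'_def)
  have nw: "?w \<notin> set ns" using parent_not_covered[OF t v _ h] by blast
  have mem: "u = ?w \<or> u \<in> set ns \<and> u \<noteq> ?w \<and> (left_of u ?w \<or> left_of ?w u)"
    if "u \<in> set (merged ?w ns)" for u
    using that nw unfolding set_merged by blast
  have rw: "\<exists>u'\<in>set ns. ranks u' \<subseteq> ranks u \<and> x \<in> E u'  \<and> E u' \<subseteq> E' u"
    if "u \<in> set (merged ?w ns)" "x \<in> E' u" for u x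
  proof (cases "u = ?w")
    case True
    then have "x \<in> below ns ?w E" using that(2) Ew by metis
    then obtain u' where "u' \<in> set ns" "ranks u' \<subseteq> ranks ?w" "x \<in> E u'"
      unfolding mem_below by metis
    then show ?thesis using True Ew below_upper by metis
  next
    case False
    then show ?thesis using that mem En by (metis order_refl)
  qed
  have "x < y" if uv: "u \<in> set (merged ?w ns)" "u' \<in> set (merged ?w ns)" "left_of u u'"
    "x \<in> E' u" "y \<in> E' u'" for u u' x y
    using rw[OF uv(1,4)] rw[OF uv(2,5)] uv(3) o left_of_subset by meson
  moreover have "\<exists>y\<in>E' u. x \<le> y \<and> (\<exists>r\<in>ranks u. p y \<le> r)"
    if "u \<in> set (merged ?w ns)" "x \<in> E' u" for u x
    using rw[OF that] hi by (meson subsetD)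
  moreover have "\<exists>y\<in>E' u. y \<le> x \<and> (\<exists>r\<in>ranks u. r \<le> p y)"
    if "u \<in> set (merged ?w ns)" "x \<in> E' u" for u x
    using rw[OF that] lo by (meson subsetD)
  ultimately show ?thesis
    using tiling_merged[OF t v h] unfolding arranged_def E'_def[symmetric] by blast
qed

definition stored :: "(node \<Rightarrow> 'a set) \<Rightarrow> (node \<Rightarrow> 'a list) \<Rightarrow> node \<Rightarrow> 'a set" where
  "stored S xs v = S v \<union> set (xs v)"

lemma stored_append: "stored S (xs(v := xs v @ [x])) = (stored S xs)(v := insert x (stored S xs v))"
  by (auto simp: stored_def fun_eq_iff)

lemma stored_init: "stored (S(v := A)) (xs(v := [])) = (stored S xs)(v := A)"
  by (auto simp: stored_def fun_eq_iff)

text \<open>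
  \<open>Y\<close> has been inserted so far; \<open>ns\<close> are the nodes of the actual LLAs and \<open>Cr\<close> those of all LLAs
  created so far. The LLA at \<open>v\<close> was initialised with \<open>S v\<close> and has since received \<open>xs v\<close>, not
  counting an overflowing insertion. If \<open>v\<close> is not a leaf, \<open>w v\<close> is the badly predicted element that
  the overflowing child held when \<open>v\<close> was created.

  A freshly initialised LLA may exceed density 1/2 by a little, and the excess can build up along
  merges. The bound \<open>4 \<cdot> 2\<^sup>h - 1\<close> on \<open>card (S v)\<close> is stable under doubling plus one.
\<close>

locale history =
  fixes k :: nat and X :: "'a::linorder set" and p :: "'a \<Rightarrow> nat" and Y :: "'a set"
    and ns :: "node list" and Cr :: "node set"
    and S :: "node \<Rightarrow> 'a set" and xs :: "node \<Rightarrow> 'a list" and w :: "node \<Rightarrow> 'a"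
  assumes finite_X: "finite X" and card_X: "card X \<le> 2 ^ k" and Y_subset: "Y \<subseteq> X"
    and arr: "arranged k p ns (stored S xs)"
    and all_stored: "(\<Union>u\<in>set ns. stored S xs u) = Y"
    and actual_created: "set ns \<subseteq> Cr" and created_nodes: "Cr \<subseteq> nodes k"
    and created_below: "\<And>v. v \<in> Cr \<Longrightarrow>
      \<exists>u\<in>set ns. ranks v \<subseteq> ranks u \<and> (0 < fst v \<longrightarrow> w v \<in> stored S xs u)"
    and witness_far: "\<And>v. v \<in> Cr \<Longrightarrow> 0 < fst v \<Longrightarrow> far p (rank_in X) (fst v - 1) (w v)"
    and witness_inj: "\<And>u v. u \<in> Cr \<Longrightarrow> v \<in> Cr \<Longrightarrow> 0 < fst v \<Longrightarrow> fst u = fst v \<Longrightarrow> w u = w v \<Longrightarrow> u = v"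
    and inserted_new: "\<And>v. v \<in> Cr \<Longrightarrow> new_elements (S v) (xs v)"
    and card_init: "\<And>v. v \<in> Cr \<Longrightarrow> card (S v) < 4 * 2 ^ fst v"
    and card_inserted: "\<And>v. v \<in> Cr \<Longrightarrow> xs v = [] \<or> card (S v) + length (xs v) \<le> 3 * 2 ^ fst v"
    and total_inserted: "(\<Sum>v\<in>Cr. length (xs v)) \<le> card Y"
begin

lemma til: "tiling k ns"
  using arr by (simp add: arranged_def)

lemma actual_node: "v \<in> set ns \<Longrightarrow> v \<in> nodes k"
  using til by (auto simp: tiling_def)

lemma finite_created: "finite Cr"
  using created_nodes finite_nodes finite_subset by blast

lemma finite_Y: "finite Y"
  using Y_subset finite_X finite_subset by blast

lemma card_stored: "v \<in> Cr \<Longrightarrow> card (stored S xs v) = card (S v) + length (xs v)"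
  using inserted_new[of v]
  by (simp add: stored_def new_elements_def card_Un_disjoint distinct_card Int_commute)

lemma card_stored_less: "v \<in> Cr \<Longrightarrow> card (stored S xs v) < 4 * 2 ^ fst v"
  using card_stored[of v] card_init[of v] card_inserted[of v] by fastforce

lemma history_append:
  assumes v: "fits ns (stored S xs) (p x) x v"
    and x: "x \<in> X" "x \<notin> Y" and c: "Suc (card (stored S xs v)) \<le> 3 * 2 ^ fst v"
  shows "history k X p (insert x Y) ns Cr S (xs(v := xs v @ [x])) w"
proof -
  let ?E = "stored S xs" let ?xs = "xs(v := xs v @ [x])"
  have vn: "v \<in> set ns" using v by (simp add: fits_def)
  then have vc: "v \<in> Cr" using actual_created by blast
  have sub: "?E u \<subseteq> stored S ?xs u" for u by (auto simp: stored_append)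
  have xv: "x \<notin> stored S xs v" using x all_stored vn by blast
  show ?thesis
  proof
    show "arranged k p ns (stored S ?xs)"
      unfolding stored_append by (rule arranged_insert[OF arr v])
    show "(\<Union>u\<in>set ns. stored S ?xs u) = insert x Y"
      unfolding stored_append all_stored[symmetric] using vn by auto
    show "\<exists>u\<in>set ns. ranks z \<subseteq> ranks u \<and> (0 < fst z \<longrightarrow> w z \<in> stored S ?xs u)" if "z \<in> Cr" for z
      using created_below[OF that] by (meson sub subsetD)
    show "new_elements (S z) (?xs z)" if "z \<in> Cr" for z
      using inserted_new[OF that] xv by (auto simp: new_elements_def stored_def)
    show "?xs z = [] \<or> card (S z) + length (?xs z) \<le> 3 * 2 ^ fst z" if "z \<in> Cr" for z
      using card_inserted[OF that] c card_stored[OF vc] by auto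
    have "(\<Sum>v\<in>Cr. length (?xs v)) = (\<Sum>u\<in>Cr. length (xs u) + (if u = v then 1 else 0))"
      by (rule sum.cong) auto
    also have "\<dots> = Suc (\<Sum>v\<in>Cr. length (xs v))"
      using finite_created vc by (simp add: sum.distrib sum.delta)
    finally show "(\<Sum>v\<in>Cr. length (?xs v)) \<le> card (insert x Y)"
      using total_inserted finite_Y x by simp
  qed (use finite_X card_X Y_subset x actual_created created_nodes witness_far witness_inj card_init
        in auto)
qed

lemma stored_subset: "v \<in> set ns \<Longrightarrow> stored S xs v \<subseteq> Y"
  using all_stored by blast

lemma overfull_height:
  assumes v: "v \<in> set ns" and x: "x \<in> X" "x \<notin> Y" and c: "3 * 2 ^ fst v < Suc (card (stored S xs v))"
  shows "fst v < k"
proof (rule ccontr)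
  assume "\<not> fst v < k"
  then have "fst v = k" using actual_node[OF v] by (auto simp: nodes_def)
  moreover have "card (insert x (stored S xs v)) \<le> card X"
    using x all_stored v Y_subset finite_X by (intro card_mono) auto
  moreover have "x \<notin> stored S xs v" using x stored_subset[OF v] by blast
  moreover have "finite (stored S xs v)" using finite_subset[OF stored_subset[OF v] finite_Y] .
  ultimately show False using c card_X by simp
qed

lemma card_below:
  assumes v: "v \<in> set ns" and h: "fst v < k"
  shows "Suc (card (below ns (parent v) (stored S xs))) < 4 * 2 ^ fst (parent v)"
proof -
  let ?E = "stored S xs" let ?w = "parent v"
  define U where "U = {u \<in> set ns. ranks u \<subseteq> ranks ?w} - {v}"
  have vn: "v \<in> nodes k" using actual_node v by blast
  have fU: "finite U" by (simp add: U_def)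
  have Un: "u \<in> set ns" "u \<in> nodes k" "u \<in> Cr" if "u \<in> U" for u
    using that actual_node actual_created by (auto simp: U_def)
  have disj: "ranks u \<inter> ranks u' = {}" if "u \<in> set ns" "u' \<in> set ns" "u \<noteq> u'" for u u'
    using tiling_eq[OF til] that by blast
  have "(\<Sum>u\<in>U. 2 ^ fst u) = (\<Sum>u\<in>U. card (ranks u))"
    using card_ranks Un(2) by (intro sum.cong refl) metis
  also have "\<dots> = card (\<Union>u\<in>U. ranks u)"
    using fU finite_ranks Un(1) disj by (intro card_UN_disjoint[symmetric]) blast+
  also have "\<dots> \<le> card (ranks ?w - ranks v)"
  proof (rule card_mono)
    show "(\<Union>u\<in>U. ranks u) \<subseteq> ranks ?w - ranks v"
      using disj[OF _ v] unfolding U_def by blast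
  qed simp
  also have "\<dots> = 2 ^ fst v"
    using card_Diff_subset[OF _ ranks_parent[OF vn]] card_ranks[OF vn]
      card_ranks[OF parent_in_nodes[OF vn h]] by simp
  finally have s: "(\<Sum>u\<in>U. 2 ^ fst u) \<le> (2::nat) ^ fst v" .
  have "{u \<in> set ns. ranks u \<subseteq> ranks ?w} = insert v U"
    using v ranks_parent[OF vn] unfolding U_def by blast
  then have "below ns ?w ?E = ?E v \<union> (\<Union>u\<in>U. ?E u)" by (simp add: below_def)
  then have b: "card (below ns ?w ?E) \<le> card (?E v) + card (\<Union>u\<in>U. ?E u)"
    by (simp add: card_Un_le)
  have "Suc (card (\<Union>u\<in>U. ?E u)) \<le> 4 * 2 ^ fst v"
  proof (cases "U = {}")
    case False
    have "card (\<Union>u\<in>U. ?E u) \<le> (\<Sum>u\<in>U. card (?E u))" by (rule card_UN_le[OF fU])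
    also have "\<dots> < (\<Sum>u\<in>U. 4 * 2 ^ fst u)"
      by (rule sum_strict_mono) (use fU False card_stored_less Un in auto)
    also have "\<dots> \<le> 4 * 2 ^ fst v" using s by (simp flip: sum_distrib_left)
    finally show ?thesis by simp
  qed simp
  then show ?thesis using b card_stored_less[of v] v actual_created by fastforce
qed

lemma history_merge:
  assumes v: "fits ns (stored S xs) (p x) x v"
    and x: "x \<in> X" "x \<notin> Y" and c: "3 * 2 ^ fst v < Suc (card (stored S xs v))"
  defines "A \<equiv> below ns (parent v) ((stored S xs)(v := insert x (stored S xs v)))"
  shows "parent v \<notin> Cr"
    and "\<exists>w'. history k X p (insert x Y) (merged (parent v) ns) (insert (parent v) Cr)
      (S(parent v := A)) (xs(parent v := [])) w'"
proof -
  let ?E = "(stored S xs)(v := insert x (stored S xs v))" let ?w = "parent v"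
  let ?ns = "merged ?w ns"
  have vn: "v \<in> set ns" using v by (simp add: fits_def)
  then have vc: "v \<in> Cr" using actual_created by blast
  have vk: "v \<in> nodes k" using actual_node vn by blast
  have h: "fst v < k" using overfull_height[OF vn x c] .
  have xv: "x \<notin> stored S xs v" using x all_stored vn by blast
  have arrE: "arranged k p ns ?E" by (rule arranged_insert[OF arr v])
  have EY: "(\<Union>u\<in>set ns. ?E u) = insert x Y" using all_stored vn by auto
  have fE: "finite (?E u)" if "u \<in> set ns" for u
    using EY that finite_Y by (metis Union_upper finite.insertI finite_subset image_eqI)
  show wc: "?w \<notin> Cr"
    using created_below parent_not_covered[OF til vn _ h] by blast
  have "\<exists>y\<in>?E v. far p (rank_in X) (fst v) y"
  proof (rule overfull_far[OF finite_X _ vk])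
    show "?E v \<subseteq> X" using stored_subset[OF vn] x Y_subset by auto
    have "finite (stored S xs v)" using fE[OF vn] by simp
    then show "3 * 2 ^ fst v < card (?E v)" using c xv by simp
  qed (use arrE vn in \<open>auto simp: arranged_def simp del: fun_upd_apply\<close>)
  then obtain y where y: "y \<in> ?E v" "far p (rank_in X) (fst v) y" by blast
  have E: "stored (S(?w := A)) (xs(?w := [])) u = (?E(?w := A)) u" if "u \<in> set ?ns" for u
  proof -
    have "u \<noteq> v"
    proof
      assume "u = v"
      then have "v = ?w \<or> left_of v ?w \<or> left_of ?w v" using that by (auto simp: set_merged)
      moreover have "v \<noteq> ?w" by (metis fst_parent n_not_Suc_n)
      ultimately show False
        using left_of_disjoint[of v ?w] left_of_disjoint[of ?w v] ranks_parent[OF vk]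
          ranks_nonempty[OF vk] by blast
    qed
    then show ?thesis by (simp add: stored_init)
  qed
  have tri: "ranks u \<subseteq> ranks ?w \<or> u \<in> set ?ns \<and> u \<noteq> ?w" if "u \<in> set ns" for u
    using parent_trichotomy[OF til vn that h] that wc actual_created unfolding set_merged by blast
  have AE: "?E u \<subseteq> A" if "u \<in> set ns" "ranks u \<subseteq> ranks ?w" for u
    using below_upper[OF that] unfolding A_def .
  have mw: "?w \<in> set ?ns" by (simp add: set_merged)
  define w' where "w' = w(?w := y)"
  have "history k X p (insert x Y) ?ns (insert ?w Cr) (S(?w := A)) (xs(?w := [])) w'"
  proof
    show "arranged k p ?ns (stored (S(?w := A)) (xs(?w := [])))"
      using arranged_merged[OF arrE vn h] E arranged_cong unfolding A_def by blast
    have "(\<Union>u\<in>set ?ns. stored (S(?w := A)) (xs(?w := [])) u) = (\<Union>u\<in>set ?ns. (?E(?w := A)) u)"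
      using E by (intro SUP_cong) auto
    also have "\<dots> = (\<Union>u\<in>set ns. ?E u)"
    proof (intro equalityI UN_least)
      fix u assume u: "u \<in> set ?ns"
      show "(?E(?w := A)) u \<subseteq> (\<Union>u\<in>set ns. ?E u)"
      proof (cases "u = ?w")
        case True
        then have "(?E(?w := A)) u = A" by simp
        then show ?thesis using below_subset unfolding A_def by (rule ord_eq_le_trans)
      next
        case False
        then have "u \<in> set ns" "(?E(?w := A)) u = ?E u" using u by (auto simp: set_merged)
        then show ?thesis by blast
      qed
    next
      fix u assume u: "u \<in> set ns"
      show "?E u \<subseteq> (\<Union>u\<in>set ?ns. (?E(?w := A)) u)"
      proof (cases "ranks u \<subseteq> ranks ?w")
        case True
        then have "?E u \<subseteq> (?E(?w := A)) ?w" using AE[OF u] by simp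
        then show ?thesis using mw by blast
      next
        case False
        then have "u \<in> set ?ns" "?E u = (?E(?w := A)) u" using tri[OF u] by auto
        then show ?thesis by blast
      qed
    qed
    finally show "(\<Union>u\<in>set ?ns. stored (S(?w := A)) (xs(?w := [])) u) = insert x Y"
      using EY by simp
    show "set ?ns \<subseteq> insert ?w Cr" using actual_created by (auto simp: set_merged)
    show "insert ?w Cr \<subseteq> nodes k" using created_nodes parent_in_nodes[OF vk h] by blast
    show "\<exists>u\<in>set ?ns. ranks z \<subseteq> ranks u \<and>
        (0 < fst z \<longrightarrow> w' z \<in> stored (S(?w := A)) (xs(?w := [])) u)"
      if z: "z \<in> insert ?w Cr" for z
    proof (cases "z = ?w")
      case True
      have "y \<in> A" using AE[OF vn ranks_parent[OF vk]] y by blast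
      then show ?thesis using True mw E[OF mw] by (intro bexI[of _ ?w]) (auto simp: w'_def)
    next
      case False
      then obtain u where u: "u \<in> set ns" "ranks z \<subseteq> ranks u" "0 < fst z \<longrightarrow> w z \<in> stored S xs u"
        using created_below[of z] z by (metis insertE)
      have uE: "stored S xs u \<subseteq> ?E u" by auto
      show ?thesis
      proof (cases "ranks u \<subseteq> ranks ?w")
        case True
        then have "0 < fst z \<longrightarrow> w z \<in> A" using u uE AE[OF u(1) True] by blast
        then show ?thesis using True u mw E[OF mw] False
          by (intro bexI[of _ ?w]) (auto simp: w'_def)
      next
        case F: False
        then have m: "u \<in> set ?ns" "u \<noteq> ?w" using tri[OF u(1)] by auto
        then have "0 < fst z \<longrightarrow> w z \<in> stored (S(?w := A)) (xs(?w := [])) u"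
          using u uE E[OF m(1)] by auto
        then show ?thesis using u m False by (intro bexI[of _ u]) (auto simp: w'_def)
      qed
    qed
    show "far p (rank_in X) (fst z - 1) (w' z)" if "z \<in> insert ?w Cr" "0 < fst z" for z
      using that witness_far[of z] y(2) by (auto simp: w'_def)
    have fresh: False if z: "z \<in> Cr" "fst z = fst ?w" "w z = y" for z
    proof -
      obtain u where u: "u \<in> set ns" "ranks z \<subseteq> ranks u" "w z \<in> stored S xs u"
        using created_below[OF z(1)] z(2) by auto
      then have "y \<in> ?E u" using z(3) by auto
      then have "u = v" using arranged_disjoint[OF arrE u(1) vn _ y(1)] by blast
      then have "card (ranks z) \<le> card (ranks v)" using u by (intro card_mono) auto
      then show False using card_ranks[OF vk] card_ranks[of z k] z created_nodes by auto
    qed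
    show "u = z" if "u \<in> insert ?w Cr" "z \<in> insert ?w Cr" "0 < fst z" "fst u = fst z" "w' u = w' z"
      for u z
    proof (cases "u = ?w"; cases "z = ?w")
      assume "u = ?w" "z \<noteq> ?w"
      moreover from this have "z \<in> Cr" "w z = y" using that by (auto simp: w'_def)
      ultimately show ?thesis using fresh that by metis
    next
      assume "u \<noteq> ?w" "z = ?w"
      moreover from this have "u \<in> Cr" "w u = y" using that by (auto simp: w'_def)
      ultimately show ?thesis using fresh that by metis
    next
      assume "u \<noteq> ?w" "z \<noteq> ?w"
      moreover from this have "u \<in> Cr" "z \<in> Cr" "w u = w z" using that by (auto simp: w'_def)
      ultimately show ?thesis using witness_inj that by metis
    qed simp
    have "finite A" unfolding A_def by (rule finite_subset[OF below_subset]) (use EY finite_Y in simp)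
    then show "new_elements ((S(?w := A)) z) ((xs(?w := [])) z)" if "z \<in> insert ?w Cr" for z
      using that inserted_new[of z] by (auto simp: new_elements_def)
    have "A = insert x (below ns ?w (stored S xs))"
      using vn ranks_parent[OF vk] unfolding A_def set_eq_iff insert_iff mem_below fun_upd_apply
      by (metis insert_iff)
    then have "card A \<le> Suc (card (below ns ?w (stored S xs)))"
      using \<open>finite A\<close> by (simp add: card_insert_if)
    then have "card A < 4 * 2 ^ fst ?w"
      using card_below[OF vn h] by (rule le_less_trans)
    then show "card ((S(?w := A)) z) < 4 * 2 ^ fst z" if "z \<in> insert ?w Cr" for z
      using that card_init[of z] by auto
    show "(xs(?w := [])) z = [] \<or> card ((S(?w := A)) z) + length ((xs(?w := [])) z) \<le> 3 * 2 ^ fst z"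
      if "z \<in> insert ?w Cr" for z
      using that card_inserted[of z] by auto
    have "(\<Sum>u\<in>insert ?w Cr. length ((xs(?w := [])) u)) = (\<Sum>u\<in>Cr. length ((xs(?w := [])) u))"
      using finite_created wc by simp
    also have "\<dots> = (\<Sum>u\<in>Cr. length (xs u))"
      by (rule sum.cong) (use wc in auto)
    finally show "(\<Sum>u\<in>insert ?w Cr. length ((xs(?w := [])) u)) \<le> card (insert x Y)"
      using total_inserted finite_Y x by simp
  qed (use finite_X card_X Y_subset x in auto)
  then show "\<exists>w'. history k X p (insert x Y) ?ns (insert ?w Cr) (S(?w := A)) (xs(?w := [])) w'"
    by blast
qed

end

lemma history_start:
  assumes "finite X" "card X \<le> 2 ^ k"
  shows "history k X p {} (map (Pair 0) [1..<Suc (2 ^ k)]) (Pair 0 ` {1..2 ^ k}) (\<lambda>_. {}) (\<lambda>_. []) w"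
proof
  show "arranged k p (map (Pair 0) [1..<Suc (2 ^ k)]) (stored (\<lambda>_. {}) (\<lambda>_. []))"
    using tiling_leaves by (simp add: arranged_def stored_def)
  show "\<exists>u\<in>set (map (Pair 0) [1..<Suc (2 ^ k)]). ranks v \<subseteq> ranks u \<and>
      (0 < fst v \<longrightarrow> w v \<in> stored (\<lambda>_. {}) (\<lambda>_. []) u)"
    if "v \<in> Pair 0 ` {1..2 ^ k}" for v
    by (rule bexI[of _ v]) (use that in auto)
qed (use assms in \<open>auto simp: stored_def nodes_def new_elements_def\<close>)

section \<open>Expected cost\<close>

lemma lla_inserts_append:
  "lla_inserts B (xs @ ys) sc = bind_pmf (lla_inserts B xs sc) (lla_inserts B ys)"
  by (induction xs arbitrary: sc) (simp_all add: bind_return_pmf bind_assoc_pmf)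

lemma lla_run_snoc:
  "lla_run B m S (xs @ [x]) = bind_pmf (lla_run B m S xs) (\<lambda>sc. map_pmf
     (\<lambda>s'. (s', snd sc + movements (label B (fst sc)) (label B s'))) (Insert B x (fst sc)))"
  unfolding lla_run_def lla_inserts_append bind_assoc_pmf map_pmf_def by (simp cong: bind_pmf_cong)

lemma lla_run_stores:
  assumes "list_labeling_array B" "new_elements S xs" "card S + length xs \<le> m"
    and "s \<in> set_pmf (map_pmf fst (lla_run B m S xs))"
  shows "stores_sorted m (S \<union> set xs) (label B s)"
proof -
  obtain c where "(s, c) \<in> set_pmf (lla_run B m S xs)" using assms(4) by auto
  then show ?thesis using assms(1-3) unfolding list_labeling_array_def by blast
qed

lemma movements_le:
  assumes "stores_sorted m A g" "finite A"
  shows "movements f g \<le> card A"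
  using assms unfolding movements_def stores_sorted_def by (intro card_mono) auto

definition insert_movements :: "('a, 's) lla \<Rightarrow> 'a \<Rightarrow> 's \<Rightarrow> ennreal" where
  "insert_movements B x s =
     (\<integral>\<^sup>+ s'. of_nat (movements (label B s) (label B s')) \<partial>measure_pmf (Insert B x s))"

definition run_cost :: "('a, 's) lla \<Rightarrow> node \<Rightarrow> 'a set \<Rightarrow> 'a list \<Rightarrow> ennreal" where
  "run_cost B v S xs = (\<integral>\<^sup>+ sc. of_nat (snd sc) \<partial>measure_pmf (lla_run B (6 * 2 ^ fst v) S xs))"

lemma run_cost_snoc:
  "run_cost B v S (xs @ [x]) = run_cost B v S xs +
     (\<integral>\<^sup>+ s. insert_movements B x s \<partial>measure_pmf (map_pmf fst (lla_run B (6 * 2 ^ fst v) S xs)))"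
  by (simp add: run_cost_def lla_run_snoc insert_movements_def nn_integral_add)

lemma run_cost_Nil:
  "run_cost B v S [] = (\<integral>\<^sup>+ s. of_nat (movements Map.empty (label B s)) \<partial>measure_pmf (Init B (6 * 2 ^ fst v) S))"
  by (simp add: run_cost_def lla_run_def)

lemma target_cong:
  fixes B :: "('a::linorder, 's) lla"
  assumes "map fst P = map fst P'" and "\<And>i. i < length P \<Longrightarrow> elements B (snd (P ! i)) = elements B (snd (P' ! i))"
  shows "target B P r x = target B P' r x"
proof -
  have l: "length P = length P'" using assms(1) by (metis length_map)
  have f: "fst (P ! i) = fst (P' ! i)" if "i < length P" for i
    using assms(1) that l by (metis nth_map)
  have ie: "index_of_element B P y = index_of_element B P' y" for y
    unfolding index_of_element_def using assms(2) l by (metis (no_types, lifting))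
  have ir: "index_of_rank P r = index_of_rank P' r"
    unfolding index_of_rank_def using f l by (metis (no_types, lifting))
  have "contents B Q = (\<Union>i<length Q. elements B (snd (Q ! i)))" for Q
    by (force simp: contents_def in_set_conv_nth)
  then have c: "contents B P = contents B P'" using assms(2) l by auto
  show ?thesis
    unfolding target_def pred_index_def succ_index_def c ie ir l by simp
qed

lemma target_fits:
  fixes B :: "('a::linorder, 's) lla"
  assumes a: "arranged k p ns E" and P: "map fst P = ns"
    and e: "\<And>i. i < length P \<Longrightarrow> elements B (snd (P ! i)) = E (fst (P ! i))"
    and fin: "finite (\<Union>u\<in>set ns. E u)" and x: "x \<notin> (\<Union>u\<in>set ns. E u)" and r: "r \<in> {1..2 ^ k}"
  shows "target B P r x < length P" "fits ns E r x (fst (P ! target B P r x))"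
proof -
  define F where "F i = elements B (snd (P ! i))" for i
  define l where "l = length P"
  have t: "tiling k ns" using a by (simp add: arranged_def)
  have len: "length ns = l" using P by (auto simp: l_def)
  have nth: "fst (P ! i) = ns ! i" if "i < l" for i using P that by (auto simp: l_def)
  have FE: "F i = E (ns ! i)" if "i < l" for i
    using e[of i] nth[OF that] that by (simp add: F_def l_def)
  have lo: "left_of (ns ! i) (ns ! j)" if "i < j" "j < l" for i j
    using t that len unfolding tiling_def sorted_wrt_iff_nth_less by blast
  have ord: "u < v" if "i < j" "j < l" "u \<in> F i" "v \<in> F j" for i j u v
  proof -
    have "i < l" using that by simp
    then have "ns ! i \<in> set ns" "ns ! j \<in> set ns" using that len by auto
    then show ?thesis
      using a lo[OF that(1,2)] that FE[OF \<open>i < l\<close>] FE[OF that(2)] unfolding arranged_def by blast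
  qed
  have uniq: "i = j" if "i < l" "j < l" "u \<in> F i" "u \<in> F j" for i j u
    using ord[of i j u u] ord[of j i u u] that by (cases i j rule: linorder_cases) auto
  have cont: "contents B P = (\<Union>i<l. F i)"
    by (force simp: contents_def in_set_conv_nth F_def l_def)
  have set_ns: "u \<in> set ns \<longleftrightarrow> (\<exists>i<l. u = ns ! i)" for u
    using len by (auto simp: in_set_conv_nth)
  have contE: "(\<Union>i<l. F i) = (\<Union>u\<in>set ns. E u)"
  proof -
    have "set ns = (!) ns ` {..<l}" using set_ns by (simp add: set_eq_iff image_iff Bex_def)
    then show ?thesis using FE by simp
  qed
  have fc: "finite (contents B P)" and xc: "x \<notin> contents B P"
    using fin x unfolding cont contE by auto
  have ind: "index_of_element B P u = i" if "i < l" "u \<in> F i" for i u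
    unfolding index_of_element_def F_def[symmetric] l_def[symmetric]
    by (rule the_equality) (use that uniq in auto)
  define ip where "ip = pred_index B P x"
  define iu where "iu = succ_index B P x"
  define ix where "ix = index_of_rank P r"
  have ns0: "0 < l" using t r len unfolding tiling_def by (cases ns) auto
  have ip: "ip < l" "(ip = 0 \<and> {y \<in> contents B P. y < x} = {})
      \<or> (\<exists>m\<in>F ip. m < x \<and> (\<forall>y\<in>contents B P. y < x \<longrightarrow> y \<le> m))"
  proof -
    let ?L = "{y \<in> contents B P. y < x}"
    have "ip < l \<and> ((ip = 0 \<and> ?L = {})
      \<or> (\<exists>m\<in>F ip. m < x \<and> (\<forall>y\<in>contents B P. y < x \<longrightarrow> y \<le> m)))"
    proof (cases "?L = {}")
      case True
      then show ?thesis using ns0 by (simp add: ip_def pred_index_def)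
    next
      case False
      have fL: "finite ?L" using fc by simp
      have m: "Max ?L \<in> ?L" using Max_in[OF fL False] .
      then obtain i where i: "i < l" "Max ?L \<in> F i" using cont by auto
      then have "ip = i" using ind[OF i] False by (auto simp: ip_def pred_index_def Let_def)
      moreover have "y \<le> Max ?L" if "y \<in> contents B P" "y < x" for y
        using that fL by simp
      ultimately show ?thesis using i m by blast
    qed
    then show "ip < l" "(ip = 0 \<and> ?L = {})
      \<or> (\<exists>m\<in>F ip. m < x \<and> (\<forall>y\<in>contents B P. y < x \<longrightarrow> y \<le> m))" by blast+
  qed
  have iu: "iu < l" "(iu = l - 1 \<and> {y \<in> contents B P. x < y} = {})
      \<or> (\<exists>m\<in>F iu. x < m \<and> (\<forall>y\<in>contents B P. x < y \<longrightarrow> m \<le> y))"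
  proof -
    let ?L = "{y \<in> contents B P. x < y}"
    have "iu < l \<and> ((iu = l - 1 \<and> ?L = {})
      \<or> (\<exists>m\<in>F iu. x < m \<and> (\<forall>y\<in>contents B P. x < y \<longrightarrow> m \<le> y)))"
    proof (cases "?L = {}")
      case True
      then show ?thesis using ns0 by (simp add: iu_def succ_index_def l_def)
    next
      case False
      have fL: "finite ?L" using fc by simp
      have m: "Min ?L \<in> ?L" using Min_in[OF fL False] .
      then obtain i where i: "i < l" "Min ?L \<in> F i" using cont by auto
      then have "iu = i" using ind[OF i] False by (auto simp: iu_def succ_index_def Let_def)
      moreover have "Min ?L \<le> y" if "y \<in> contents B P" "x < y" for y
        using that fL by simp
      ultimately show ?thesis using i m by blast
    qed
    then show "iu < l" "(iu = l - 1 \<and> ?L = {})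
      \<or> (\<exists>m\<in>F iu. x < m \<and> (\<forall>y\<in>contents B P. x < y \<longrightarrow> m \<le> y))" by blast+
  qed
  obtain u where u: "u \<in> set ns" "r \<in> ranks u" using t r unfolding tiling_def by blast
  then obtain i where i: "i < l" "u = ns ! i" using set_ns by blast
  have ix: "ix = i"
    unfolding ix_def index_of_rank_def l_def[symmetric]
  proof (rule the_equality)
    show "i < l \<and> r \<in> ranks (fst (P ! i))" using i u nth by simp
    fix j assume j: "j < l \<and> r \<in> ranks (fst (P ! j))"
    then have "ns ! j \<in> set ns" "r \<in> ranks (ns ! j)" using nth len by auto
    then have "ns ! j = ns ! i" using tiling_eq[OF t, of "ns ! j" u] i u by blast
    then show "j = i" using tiling_distinct[OF t] i j len by (simp add: nth_eq_iff_index_eq)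
  qed
  have ixl: "ix < l" and rx: "r \<in> ranks (ns ! ix)" using i ix u by auto
  have inc: "y \<in> contents B P" if "j < l" "y \<in> F j" for j y using that cont by blast
  have nx: "y \<noteq> x" if "j < l" "y \<in> F j" for j y using that inc xc by blast
  have p1: "y < x" if "j < ip" "y \<in> F j" for j y
  proof -
    have "ip \<noteq> 0" using that by linarith
    then obtain m where m: "m \<in> F ip" "m < x" using ip(2) by blast
    then show ?thesis using ord[OF that(1) ip(1) that(2) m(1)] by simp
  qed
  have p2: "x < y" if "ip < j" "j < l" "y \<in> F j" for j y
  proof (rule ccontr)
    assume "\<not> x < y"
    then have "y < x" using nx that by (metis linorder_neqE)
    then show False using ip(2) inc[OF that(2,3)] ord[OF that(1,2) _ that(3)] by fastforce
  qed
  have s1: "x < y" if "iu < j" "j < l" "y \<in> F j" for j y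
  proof -
    have "iu \<noteq> l - 1" using that by linarith
    then obtain m where m: "m \<in> F iu" "x < m" using iu(2) by blast
    then show ?thesis using ord[OF that(1,2) m(1) that(3)] by simp
  qed
  have s2: "y < x" if "j < iu" "y \<in> F j" for j y
  proof (rule ccontr)
    have jl: "j < l" using that iu by simp
    assume "\<not> y < x"
    then have "x < y" using nx[OF jl] that by (metis linorder_neqE)
    then show False using iu(2) inc[OF jl that(2)] ord[OF that(1) iu(1) that(2)] by fastforce
  qed
  have ps: "ip \<le> iu"
  proof (rule ccontr)
    assume n: "\<not> ip \<le> iu"
    then obtain m where "m \<in> F ip" "m < x" using ip(2) by auto
    moreover have "x < m" using s1[of ip m] n ip(1) calculation by simp
    ultimately show False by simp
  qed
  define tt where "tt = target B P r x"
  have tt: "tt = (if ip > ix then ip else if iu < ix then iu else ix)"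
    by (simp add: tt_def target_def ip_def iu_def ix_def Let_def)
  have tl: "tt < l" using tt ip iu ixl by simp
  then show "target B P r x < length P" by (simp add: tt_def l_def)
  have btw: "ip \<le> tt" "tt \<le> iu" using tt ps by auto
  let ?v = "ns ! tt"
  have vn: "?v \<in> set ns" using tl len by simp
  have nodes: "z \<in> nodes k" if "z \<in> set ns" for z using that t by (auto simp: tiling_def)
  have left: "y < x" if z: "z \<in> set ns" "left_of z ?v" "y \<in> E z" for z y
  proof -
    obtain j where j: "j < l" "z = ns ! j" using z set_ns by blast
    have "j < tt"
    proof (rule ccontr)
      assume "\<not> j < tt"
      then have "z = ?v \<or> left_of ?v z" using lo[of tt j] j by (cases "j = tt") auto
      then show False
        using z(2) not_left_of_self[OF nodes[OF vn]] left_of_antisym[OF z(2) nodes[OF z(1)] nodes[OF vn]]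
        by blast
    qed
    then show ?thesis using s2[of j y] btw z j FE by simp
  qed
  have right: "x < y" if z: "z \<in> set ns" "left_of ?v z" "y \<in> E z" for z y
  proof -
    obtain j where j: "j < l" "z = ns ! j" using z set_ns by blast
    have "tt < j"
    proof (rule ccontr)
      assume "\<not> tt < j"
      then have "z = ?v \<or> left_of z ?v" using lo[of j tt] tl j by (cases "j = tt") auto
      then show False
        using z(2) not_left_of_self[OF nodes[OF vn]] left_of_antisym[OF z(2) nodes[OF vn] nodes[OF z(1)]]
        by blast
    qed
    then show ?thesis using p2[of j y] btw z j FE by simp
  qed
  have "((\<exists>q\<in>ranks ?v. r \<le> q) \<or> (\<exists>y\<in>E ?v. x < y)) \<and> ((\<exists>q\<in>ranks ?v. q \<le> r) \<or> (\<exists>y\<in>E ?v. y < x))"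
  proof -
    obtain q where q: "q \<in> ranks ?v" using ranks_nonempty[OF nodes[OF vn]] by blast
    consider "tt = ix" | "ix < ip" "tt = ip" | "\<not> ix < ip" "iu < ix" "tt = iu" using tt by presburger
    then show ?thesis
    proof cases
      case 1
      then show ?thesis using rx by blast
    next
      case 2
      then have "r < q" using lo[of ix ip] ip(1) rx q unfolding left_of_def by blast
      moreover have "\<exists>m\<in>F ip. m < x" using ip(2) 2 by auto
      ultimately show ?thesis using q 2 FE[OF ip(1)] by (metis less_imp_le)
    next
      case 3
      then have "q < r" using lo[of "iu" ix] ixl rx q unfolding left_of_def by blast
      moreover have "\<exists>m\<in>F iu. x < m" using iu(2) 3 ixl by auto
      ultimately show ?thesis using q 3 FE[OF iu(1)] by (metis less_imp_le)
    qed
  qed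
  then have "fits ns E r x ?v" unfolding fits_def using vn left right by blast
  then show "fits ns E r x (fst (P ! target B P r x))" using nth[OF tl] by (simp add: tt_def)
qed

lemma contents_at_below:
  assumes P: "map fst P = ns" and ns: "set ns \<subseteq> nodes k"
    and s: "\<And>u s. (u, s) \<in> set P \<Longrightarrow> stores_sorted (6 * 2 ^ fst u) (E u) (label B s)"
    and w: "w \<in> nodes k" "\<And>u. u \<in> set ns \<Longrightarrow> ranks u \<subseteq> ranks w \<or> left_of u w \<or> left_of w u"
  shows "contents_at B P w = below ns w E"
proof (intro set_eqI)
  fix x
  have l: "(\<exists>j. label B s x = Some j \<and> slot u j \<in> slots w) \<longleftrightarrow> ranks u \<subseteq> ranks w \<and> x \<in> E u"
    if us: "(u, s) \<in> set P" for u s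
  proof -
    have u: "u \<in> set ns" using us P by force
    then have un: "u \<in> nodes k" using ns by blast
    have d: "dom (label B s) = E u" "ran (label B s) \<subseteq> {1..6 * 2 ^ fst u}"
      using s[OF us] by (auto simp: stores_sorted_def)
    have "slot u j \<in> slots w \<longleftrightarrow> ranks u \<subseteq> ranks w" if "label B s x = Some j" for j
      using slot_in_slots_iff[OF un w(1) _ w(2)[OF u]] ranI[of "label B s" x j] that d(2) by blast
    moreover have "x \<in> E u \<longleftrightarrow> (\<exists>j. label B s x = Some j)" using d(1) by blast
    ultimately show ?thesis by blast
  qed
  have "x \<in> contents_at B P w \<longleftrightarrow> (\<exists>(u, s)\<in>set P. \<exists>j. label B s x = Some j \<and> slot u j \<in> slots w)"
    unfolding contents_at_def by blast
  also have "\<dots> \<longleftrightarrow> (\<exists>(u, s)\<in>set P. ranks u \<subseteq> ranks w \<and> x \<in> E u)" using l by blast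
  also have "\<dots> \<longleftrightarrow> x \<in> below ns w E" unfolding mem_below P[symmetric] by (simp add: case_prod_unfold)
  finally show "x \<in> contents_at B P w \<longleftrightarrow> x \<in> below ns w E" .
qed

lemma map_of_filter_key: "map_of (filter (\<lambda>(u, s). Q u) P) u = (if Q u then map_of P u else None)"
  by (induction P) auto

lemma map_fst_filter_key: "map fst (filter (\<lambda>(u, s). Q u) P) = filter Q (map fst P)"
  by (induction P) auto

lemma map_fst_replace_descendants:
  "map fst (replace_descendants w t P) = merged w (map fst P)"
  by (simp add: replace_descendants_def merged_def map_fst_filter_key)

lemma map_of_replace_descendants:
  assumes "w \<notin> set (map fst P)" "u \<in> set (merged w (map fst P))"
  shows "map_of (replace_descendants w t P) u = (if u = w then Some t else map_of P u)"
proof -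
  have "map_of P w = None" using assms(1) by (simp add: map_of_eq_None_iff)
  then show ?thesis
    using assms(2)
    by (auto simp: replace_descendants_def map_of_filter_key map_add_def set_merged
        split: option.splits)
qed

lemma map_of_list_update:
  assumes "distinct (map fst P)" "i < length P" "fst (P ! i) = v"
  shows "map_of (P[i := (v, s)]) u = (if u = v then Some s else map_of P u)"
  using assms
proof (induction P arbitrary: i)
  case (Cons a P)
  show ?case
  proof (cases i)
    case (Suc j)
    have j: "j < length P" "fst (P ! j) = v" using Cons.prems Suc by auto
    then have "v \<in> fst ` set P" by (metis image_eqI nth_mem)
    moreover have "fst a \<notin> fst ` set P" using Cons.prems(1) by simp
    ultimately have "fst a \<noteq> v" by metis
    then show ?thesis using Cons.IH[OF _ j] Cons.prems(1) Suc by (cases a) auto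
  qed (use Cons in \<open>cases a, auto\<close>)
qed simp

definition state_at :: "'s learned \<times> nat \<Rightarrow> node \<Rightarrow> 's" where
  "state_at Pc u = the (map_of (fst Pc) u)"

definition learned_step ::
  "('a::linorder, 's) lla \<Rightarrow> nat \<Rightarrow> 'a \<Rightarrow> 's learned \<times> nat \<Rightarrow> ('s learned \<times> nat) pmf" where
  "learned_step B r x Pc = map_pmf (\<lambda>Pd. (fst Pd, snd Pc + snd Pd)) (learned_insert B r x (fst Pc))"

lemma learned_inserts_Cons:
  "learned_inserts B p (x # xs) Pc = bind_pmf (learned_step B (p x) x Pc) (learned_inserts B p xs)"
  by (simp add: learned_step_def bind_map_pmf)

lemma density_gt_half:
  assumes "v \<in> nodes k"
  shows "density B v s > 1 / 2 \<longleftrightarrow> 3 * 2 ^ fst v < card (elements B s)"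
proof -
  have "density B v s > 1 / 2 \<longleftrightarrow> real (3 * 2 ^ fst v) < real (card (elements B s))"
    unfolding density_def card_slots[OF assms] by (simp add: field_simps)
  then show ?thesis by linarith
qed

text \<open>Only the marginal law of each actual array is tracked: by linearity of expectation the joint
  law is irrelevant for the expected cost.\<close>

locale simulation = history k X p Y ns Cr S xs w
  for k :: nat and X :: "'a::linorder set" and p :: "'a \<Rightarrow> nat" and Y :: "'a set"
    and ns :: "node list" and Cr :: "node set"
    and S :: "node \<Rightarrow> 'a set" and xs :: "node \<Rightarrow> 'a list" and w :: "node \<Rightarrow> 'a" +
  fixes B :: "('a, 's) lla" and q :: "('s learned \<times> nat) pmf"
  assumes correct: "list_labeling_array B"
    and shape: "\<And>Pc. Pc \<in> set_pmf q \<Longrightarrow> map fst (fst Pc) = ns"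
    and marginal: "\<And>u. u \<in> set ns \<Longrightarrow>
      map_pmf (\<lambda>Pc. state_at Pc u) q = map_pmf fst (lla_run B (6 * 2 ^ fst u) (S u) (xs u))"
    and cost: "(\<integral>\<^sup>+ Pc. of_nat (snd Pc) \<partial>measure_pmf q)
      \<le> (\<Sum>v\<in>Cr. run_cost B v (S v) (xs v) + of_nat (4 * 2 ^ fst v))"
begin

lemma state_in_run:
  assumes "Pc \<in> set_pmf q" "u \<in> set ns"
  shows "state_at Pc u \<in> set_pmf (map_pmf fst (lla_run B (6 * 2 ^ fst u) (S u) (xs u)))"
proof -
  have "state_at Pc u \<in> set_pmf (map_pmf (\<lambda>Pc. state_at Pc u) q)" using assms(1) by simp
  then show ?thesis unfolding marginal[OF assms(2)] .
qed

lemma state_stores: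
  assumes "Pc \<in> set_pmf q" "u \<in> set ns"
  shows "stores_sorted (6 * 2 ^ fst u) (stored S xs u) (label B (state_at Pc u))"
proof -
  have u: "u \<in> Cr" using assms actual_created by blast
  have "card (S u) + length (xs u) \<le> 6 * 2 ^ fst u"
    using card_stored_less[OF u] card_stored[OF u] by simp
  then show ?thesis
    unfolding stored_def by (rule lla_run_stores[OF correct inserted_new[OF u] _ state_in_run[OF assms]])
qed

lemma elements_state:
  "Pc \<in> set_pmf q \<Longrightarrow> u \<in> set ns \<Longrightarrow> elements B (state_at Pc u) = stored S xs u"
  using state_stores by (auto simp: elements_def stores_sorted_def)

lemma state_nth:
  assumes "Pc \<in> set_pmf q" "i < length ns"
  shows "fst Pc ! i = (ns ! i, state_at Pc (ns ! i))"
proof -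
  note s = shape[OF assms(1)]
  have l: "length (fst Pc) = length ns" using s by (metis length_map)
  have d: "distinct (map fst (fst Pc))" using s tiling_distinct[OF til] by simp
  have f: "fst (fst Pc ! i) = ns ! i" using s l assms(2) by (metis nth_map)
  have "fst Pc ! i \<in> set (fst Pc)" using l assms(2) by simp
  then have "map_of (fst Pc) (ns ! i) = Some (snd (fst Pc ! i))"
    using d f by (metis map_of_is_SomeI prod.collapse)
  then show ?thesis using f by (simp add: state_at_def prod_eq_iff)
qed

lemma insert_stores:
  assumes Pc: "Pc \<in> set_pmf q" and v: "v \<in> set ns" and x: "x \<notin> Y"
    and s': "s' \<in> set_pmf (Insert B x (state_at Pc v))"
  shows "stores_sorted (6 * 2 ^ fst v) (insert x (stored S xs v)) (label B s')"
proof -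
  have vc: "v \<in> Cr" using v actual_created by blast
  have xv: "x \<notin> stored S xs v" using x stored_subset[OF v] by blast
  have c: "card (S v) + length (xs v @ [x]) \<le> 6 * 2 ^ fst v"
    using card_stored_less[OF vc] card_stored[OF vc] by simp
  have n: "new_elements (S v) (xs v @ [x])"
    using inserted_new[OF vc] xv by (auto simp: new_elements_def stored_def)
  have "s' \<in> set_pmf (map_pmf fst (lla_run B (6 * 2 ^ fst v) (S v) (xs v @ [x])))"
    unfolding lla_run_snoc using state_in_run[OF Pc v] s' by force
  then have "stores_sorted (6 * 2 ^ fst v) (S v \<union> set (xs v @ [x])) (label B s')"
    using lla_run_stores[OF correct n c] by blast
  then show ?thesis by (simp add: stored_def)
qed

lemma obtain_target:
  assumes x: "x \<notin> Y" and r: "p x \<in> {1..2 ^ k}"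
  obtains i where "i < length ns" "fits ns (stored S xs) (p x) x (ns ! i)"
    "\<And>Pc. Pc \<in> set_pmf q \<Longrightarrow> target B (fst Pc) (p x) x = i"
proof -
  obtain Pc where Pc: "Pc \<in> set_pmf q" using set_pmf_not_empty[of q] by blast
  define i where "i = target B (fst Pc) (p x) x"
  have l: "length (fst Pc) = length ns" if "Pc \<in> set_pmf q" for Pc
    using shape[OF that] by (metis length_map)
  have e: "elements B (snd (fst Pc ! j)) = stored S xs (ns ! j)"
    if "Pc \<in> set_pmf q" "j < length ns" for Pc j
    using state_nth[OF that] elements_state[OF that(1)] that(2) by simp
  have e': "elements B (snd (fst Pc ! j)) = stored S xs (fst (fst Pc ! j))"
    if "j < length (fst Pc)" for j
    using state_nth[OF Pc, of j] e[OF Pc, of j] that l[OF Pc] by simp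
  have fin: "finite (\<Union>u\<in>set ns. stored S xs u)" "x \<notin> (\<Union>u\<in>set ns. stored S xs u)"
    using all_stored finite_Y x by auto
  note T = target_fits[OF arr shape[OF Pc] e' fin r]
  have i: "i < length ns" using T(1) l[OF Pc] by (simp add: i_def)
  moreover have "fits ns (stored S xs) (p x) x (ns ! i)"
    using T(2) state_nth[OF Pc i] unfolding i_def[symmetric] by simp
  moreover have "target B (fst Pc') (p x) x = i" if "Pc' \<in> set_pmf q" for Pc'
    unfolding i_def using shape[OF Pc] shape[OF that] e[OF Pc] e[OF that] l[OF that]
    by (intro target_cong) simp_all
  ultimately show ?thesis using that by blast
qed

lemma map_of_state_update:
  assumes "Pc \<in> set_pmf q" "i < length ns"
  shows "map_of ((fst Pc)[i := (ns ! i, s')]) u = (if u = ns ! i then Some s' else map_of (fst Pc) u)"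
proof (rule map_of_list_update)
  show "distinct (map fst (fst Pc))" using shape[OF assms(1)] tiling_distinct[OF til] by simp
  show "i < length (fst Pc)" using shape[OF assms(1)] assms(2) by (metis length_map)
  show "fst (fst Pc ! i) = ns ! i" using state_nth[OF assms] by simp
qed

lemma nn_integral_insert:
  assumes "v \<in> set ns"
  shows "(\<integral>\<^sup>+ Pc. insert_movements B x (state_at Pc v) \<partial>measure_pmf q) =
    (\<integral>\<^sup>+ s. insert_movements B x s \<partial>measure_pmf (map_pmf fst (lla_run B (6 * 2 ^ fst v) (S v) (xs v))))"
  unfolding marginal[OF assms, symmetric] by simp

lemma simulation_append:
  assumes i: "i < length ns" "fits ns (stored S xs) (p x) x (ns ! i)"
    and tgt: "\<And>Pc. Pc \<in> set_pmf q \<Longrightarrow> target B (fst Pc) (p x) x = i"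
    and x: "x \<in> X" "x \<notin> Y" and c: "Suc (card (stored S xs (ns ! i))) \<le> 3 * 2 ^ fst (ns ! i)"
  shows "simulation k X p (insert x Y) ns Cr S (xs(ns ! i := xs (ns ! i) @ [x])) w B
    (bind_pmf q (learned_step B (p x) x))"
proof -
  define v where "v = ns ! i"
  let ?xs = "xs(v := xs v @ [x])"
  have vn: "v \<in> set ns" using i by (simp add: v_def)
  have vc: "v \<in> Cr" using vn actual_created by blast
  have vk: "v \<in> nodes k" using actual_node vn by blast
  have fin: "finite (stored S xs v)" using finite_subset[OF stored_subset[OF vn] finite_Y] .
  have xv: "x \<notin> stored S xs v" using x stored_subset[OF vn] by blast
  have step: "learned_step B (p x) x Pc =
      map_pmf (\<lambda>s'. ((fst Pc)[i := (v, s')], snd Pc + movements (label B (state_at Pc v)) (label B s')))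
        (Insert B x (state_at Pc v))" if Pc: "Pc \<in> set_pmf q" for Pc
  proof -
    have nd: "\<not> density B v s' > 1 / 2" if "s' \<in> set_pmf (Insert B x (state_at Pc v))" for s'
      unfolding density_gt_half[OF vk]
      using insert_stores[OF Pc vn x(2) that] c xv fin
      by (simp add: elements_def stores_sorted_def v_def)
    have "learned_insert B (p x) x (fst Pc) =
      map_pmf (\<lambda>s'. ((fst Pc)[i := (v, s')], movements (label B (state_at Pc v)) (label B s')))
        (Insert B x (state_at Pc v))"
      unfolding learned_insert_def tgt[OF Pc] state_nth[OF Pc i(1)] fst_conv snd_conv Let_def
        v_def[symmetric] map_pmf_def
      by (rule bind_pmf_cong) (use nd in simp_all)
    then show ?thesis by (simp add: learned_step_def pmf.map_comp o_def)
  qed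
  have q': "bind_pmf q (learned_step B (p x) x) = bind_pmf q (\<lambda>Pc.
      map_pmf (\<lambda>s'. ((fst Pc)[i := (v, s')], snd Pc + movements (label B (state_at Pc v)) (label B s')))
        (Insert B x (state_at Pc v)))" (is "_ = ?q'")
    by (rule bind_pmf_cong) (use step in simp_all)
  have "history k X p (insert x Y) ns Cr S ?xs w"
    by (rule history_append) (use i x c in \<open>simp_all add: v_def\<close>)
  then interpret H: history k X p "insert x Y" ns Cr S ?xs w .
  have "simulation k X p (insert x Y) ns Cr S ?xs w B ?q'"
  proof
    fix Pc assume "Pc \<in> set_pmf ?q'"
    then obtain Pc0 s' where "Pc0 \<in> set_pmf q" "fst Pc = (fst Pc0)[i := (v, s')]" by auto
    then show "map fst (fst Pc) = ns"
      using shape by (simp add: map_update v_def)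
  next
    fix u assume u: "u \<in> set ns"
    show "map_pmf (\<lambda>Pc. state_at Pc u) ?q' =
      map_pmf fst (lla_run B (6 * 2 ^ fst u) (S u) (?xs u))"
    proof (cases "u = v")
      case True
      have "map_pmf (\<lambda>Pc. state_at Pc u) ?q' = bind_pmf q (\<lambda>Pc. Insert B x (state_at Pc v))"
        unfolding map_bind_pmf pmf.map_comp o_def
        by (rule bind_pmf_cong)
          (use True map_of_state_update i(1) in \<open>simp_all add: state_at_def v_def\<close>)
      also have "\<dots> = bind_pmf (map_pmf (\<lambda>Pc. state_at Pc v) q) (Insert B x)"
        by (simp add: bind_map_pmf)
      also have "\<dots> = map_pmf fst (lla_run B (6 * 2 ^ fst v) (S v) (xs v @ [x]))"
        unfolding marginal[OF vn] lla_run_snoc map_bind_pmf pmf.map_comp o_def bind_map_pmf by simp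
      finally show ?thesis using True by simp
    next
      case False
      have "map_pmf (\<lambda>Pc. state_at Pc u) ?q' = bind_pmf q (\<lambda>Pc. return_pmf (state_at Pc u))"
        unfolding map_bind_pmf pmf.map_comp o_def
        by (rule bind_pmf_cong)
          (use False map_of_state_update i(1) in \<open>simp_all add: state_at_def v_def\<close>)
      also have "\<dots> = map_pmf (\<lambda>Pc. state_at Pc u) q" by (simp add: map_pmf_def)
      finally show ?thesis using False marginal[OF u] by simp
    qed
  next
    let ?R = "\<lambda>xs v. run_cost B v (S v) (xs v) + of_nat (4 * 2 ^ fst v)"
    have "(\<integral>\<^sup>+ Pc. of_nat (snd Pc) \<partial>measure_pmf ?q') =
        (\<integral>\<^sup>+ Pc. of_nat (snd Pc) + insert_movements B x (state_at Pc v) \<partial>measure_pmf q)"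
      by (simp add: insert_movements_def nn_integral_add)
    also have "\<dots> = (\<integral>\<^sup>+ Pc. of_nat (snd Pc) \<partial>measure_pmf q) +
        (\<integral>\<^sup>+ Pc. insert_movements B x (state_at Pc v) \<partial>measure_pmf q)"
      by (simp add: nn_integral_add)
    also have "\<dots> \<le> (\<Sum>v\<in>Cr. ?R xs v) +
        (\<integral>\<^sup>+ Pc. insert_movements B x (state_at Pc v) \<partial>measure_pmf q)"
      by (rule add_right_mono[OF cost])
    also have "\<dots> = (\<Sum>u\<in>Cr - {v}. ?R xs u) + ?R ?xs v"
      unfolding nn_integral_insert[OF vn] sum.remove[OF finite_created vc]
      by (simp add: run_cost_snoc algebra_simps)
    also have "(\<Sum>u\<in>Cr - {v}. ?R xs u) = (\<Sum>u\<in>Cr - {v}. ?R ?xs u)"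
      by (rule sum.cong) auto
    also have "\<dots> + ?R ?xs v = (\<Sum>u\<in>Cr. ?R ?xs u)"
      unfolding sum.remove[OF finite_created vc] by (simp add: add.commute)
    finally show "(\<integral>\<^sup>+ Pc. of_nat (snd Pc) \<partial>measure_pmf ?q') \<le> (\<Sum>u\<in>Cr. ?R ?xs u)" .
  qed (rule correct)
  then show ?thesis unfolding q' v_def .
qed

lemma simulation_merge:
  assumes i: "i < length ns" "fits ns (stored S xs) (p x) x (ns ! i)"
    and tgt: "\<And>Pc. Pc \<in> set_pmf q \<Longrightarrow> target B (fst Pc) (p x) x = i"
    and x: "x \<in> X" "x \<notin> Y" and c: "3 * 2 ^ fst (ns ! i) < Suc (card (stored S xs (ns ! i)))"
  shows "\<exists>ns' Cr' S' xs' w'. simulation k X p (insert x Y) ns' Cr' S' xs' w' B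
    (bind_pmf q (learned_step B (p x) x))"
proof -
  define v where "v = ns ! i"
  define z where "z = parent v"
  define E where "E = (stored S xs)(v := insert x (stored S xs v))"
  define A where "A = below ns z E"
  note fv = i(2)[folded v_def] and cv = c[folded v_def]
  have vn: "v \<in> set ns" using i by (simp add: v_def)
  have vc: "v \<in> Cr" using vn actual_created by blast
  have vk: "v \<in> nodes k" using actual_node vn by blast
  have h: "fst v < k" using overfull_height[OF vn x cv] .
  have zk: "z \<in> nodes k" unfolding z_def by (rule parent_in_nodes[OF vk h])
  have fz: "fst z = Suc (fst v)" by (simp add: z_def)
  have fin: "finite (stored S xs v)" using finite_subset[OF stored_subset[OF vn] finite_Y] .
  have xv: "x \<notin> stored S xs v" using x stored_subset[OF vn] by blast
  have cx: "card (insert x (stored S xs v)) \<le> 4 * 2 ^ fst z"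
    using card_stored_less[OF vc] fin xv fz by simp
  have zc: "z \<notin> Cr" unfolding z_def by (rule history_merge(1)[OF fv x cv])
  then have zn: "z \<notin> set ns" using actual_created by blast
  let ?ns = "merged z ns" and ?Cr = "insert z Cr" and ?S = "S(z := A)" and ?xs = "xs(z := [])"
  obtain w' where H: "history k X p (insert x Y) ?ns ?Cr ?S ?xs w'"
    using history_merge(2)[OF fv x cv] unfolding A_def E_def z_def by blast
  define new where "new Pc s' t = (replace_descendants z t ((fst Pc)[i := (v, s')]),
    snd Pc + (movements (label B (state_at Pc v)) (label B s') + movements Map.empty (label B t)))"
    for Pc :: "'s learned \<times> nat" and s' t
  have shape': "map fst ((fst Pc)[i := (v, s')]) = ns" if "Pc \<in> set_pmf q" for Pc s'
    using shape[OF that] by (simp add: map_update v_def)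
  have step: "learned_step B (p x) x Pc = bind_pmf (Insert B x (state_at Pc v)) (\<lambda>s'.
      map_pmf (new Pc s') (Init B (6 * 2 ^ fst z) A))" if Pc: "Pc \<in> set_pmf q" for Pc
  proof -
    have d: "density B v s' > 1 / 2" if "s' \<in> set_pmf (Insert B x (state_at Pc v))" for s'
      unfolding density_gt_half[OF vk]
      using insert_stores[OF Pc vn x(2) that] cv xv fin
      by (simp add: elements_def stores_sorted_def)
    have ca: "contents_at B ((fst Pc)[i := (v, s')]) z = A"
      if s': "s' \<in> set_pmf (Insert B x (state_at Pc v))" for s'
      unfolding A_def
    proof (rule contents_at_below[OF shape'[OF Pc]])
      show "set ns \<subseteq> nodes k" using actual_node by blast
      show "ranks u \<subseteq> ranks z \<or> left_of u z \<or> left_of z u" if "u \<in> set ns" for u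
        unfolding z_def by (rule parent_trichotomy[OF til vn that h])
      fix u s assume us: "(u, s) \<in> set ((fst Pc)[i := (v, s')])"
      then have u: "u \<in> set ns" using shape'[OF Pc] by (metis fst_conv image_eqI set_map)
      have "distinct (map fst ((fst Pc)[i := (v, s')]))"
        unfolding shape'[OF Pc] by (rule tiling_distinct[OF til])
      then have "map_of ((fst Pc)[i := (v, s')]) u = Some s" using us by simp
      then have "s = (if u = v then s' else state_at Pc u)"
        using map_of_state_update[OF Pc i(1)] by (auto simp: v_def state_at_def split: if_splits)
      then show "stores_sorted (6 * 2 ^ fst u) (E u) (label B s)"
        using insert_stores[OF Pc vn x(2) s'] state_stores[OF Pc u] by (simp add: E_def)
    qed (rule zk)
    have "learned_insert B (p x) x (fst Pc) = bind_pmf (Insert B x (state_at Pc v)) (\<lambda>s'.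
      map_pmf (\<lambda>t. (replace_descendants z t ((fst Pc)[i := (v, s')]),
        movements (label B (state_at Pc v)) (label B s') + movements Map.empty (label B t)))
       (Init B (6 * 2 ^ fst z) A))"
      unfolding learned_insert_def tgt[OF Pc] state_nth[OF Pc i(1)] fst_conv snd_conv Let_def
        v_def[symmetric] z_def[symmetric] map_pmf_def card_slots[OF zk]
      by (rule bind_pmf_cong) (use d ca in simp_all)
    then show ?thesis
      by (simp add: learned_step_def map_bind_pmf pmf.map_comp o_def new_def[abs_def])
  qed
  have q': "bind_pmf q (learned_step B (p x) x) = bind_pmf q (\<lambda>Pc.
      bind_pmf (Insert B x (state_at Pc v)) (\<lambda>s'.
        map_pmf (new Pc s') (Init B (6 * 2 ^ fst z) A)))" (is "_ = ?q'")
    by (rule bind_pmf_cong) (use step in simp_all)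
  have state_new: "state_at (new Pc s' t) u = (if u = z then t else state_at Pc u)"
    if Pc: "Pc \<in> set_pmf q" and u: "u \<in> set ?ns" for Pc s' t u
  proof -
    have "u \<noteq> v"
    proof
      assume "u = v"
      then have "v = z \<or> left_of v z \<or> left_of z v" using u by (auto simp: set_merged)
      moreover have "v \<noteq> z" using vn zn by blast
      ultimately show False
        using left_of_disjoint[of v z] left_of_disjoint[of z v] ranks_parent[OF vk]
          ranks_nonempty[OF vk] unfolding z_def by blast
    qed
    moreover have "map_of (replace_descendants z t ((fst Pc)[i := (v, s')])) u =
        (if u = z then Some t else map_of ((fst Pc)[i := (v, s')]) u)"
      using map_of_replace_descendants[of z "(fst Pc)[i := (v, s')]" u t] zn u
      unfolding shape'[OF Pc] by blast
    ultimately show ?thesis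
      using map_of_state_update[OF Pc i(1), of s' u] by (simp add: state_at_def new_def v_def)
  qed
  interpret H: history k X p "insert x Y" ?ns ?Cr ?S ?xs w' by (rule H)
  have "simulation k X p (insert x Y) ?ns ?Cr ?S ?xs w' B ?q'"
  proof
    fix Pc assume "Pc \<in> set_pmf ?q'"
    then obtain Pc0 s' t where "Pc0 \<in> set_pmf q" "Pc = new Pc0 s' t" by auto
    then show "map fst (fst Pc) = ?ns"
      using shape' by (simp add: new_def map_fst_replace_descendants)
  next
    fix u assume u: "u \<in> set ?ns"
    show "map_pmf (\<lambda>Pc. state_at Pc u) ?q' =
      map_pmf fst (lla_run B (6 * 2 ^ fst u) (?S u) (?xs u))"
    proof (cases "u = z")
      case True
      have "map_pmf (\<lambda>Pc. state_at Pc u) ?q' = bind_pmf q (\<lambda>Pc.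
          bind_pmf (Insert B x (state_at Pc v)) (\<lambda>s'. Init B (6 * 2 ^ fst z) A))"
        unfolding map_bind_pmf pmf.map_comp o_def
        by (intro bind_pmf_cong refl) (use state_new[OF _ u] True in simp_all)
      also have "\<dots> = map_pmf fst (lla_run B (6 * 2 ^ fst z) A [])"
        by (simp add: lla_run_def map_bind_pmf bind_return_pmf')
      finally show ?thesis using True by simp
    next
      case False
      then have un: "u \<in> set ns" using u by (auto simp: set_merged)
      have "map_pmf (\<lambda>Pc. state_at Pc u) ?q' = bind_pmf q (\<lambda>Pc. return_pmf (state_at Pc u))"
        unfolding map_bind_pmf pmf.map_comp o_def
        by (rule bind_pmf_cong) (use state_new[OF _ u] False in simp_all)
      also have "\<dots> = map_pmf (\<lambda>Pc. state_at Pc u) q" by (simp add: map_pmf_def)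
      finally show ?thesis using False marginal[OF un] by simp
    qed
  next
    let ?R = "\<lambda>S xs v. run_cost B v (S v) (xs v) + of_nat (4 * 2 ^ fst v)"
    have d: "insert_movements B x (state_at Pc v) \<le> of_nat (4 * 2 ^ fst z)" if Pc: "Pc \<in> set_pmf q" for Pc
    proof -
      have "insert_movements B x (state_at Pc v)
        \<le> (\<integral>\<^sup>+ s'. of_nat (4 * 2 ^ fst z) \<partial>measure_pmf (Insert B x (state_at Pc v)))"
        unfolding insert_movements_def
      proof (rule nn_integral_mono_AE, unfold AE_measure_pmf_iff, intro ballI)
        fix s' assume "s' \<in> set_pmf (Insert B x (state_at Pc v))"
        then have "movements (label B (state_at Pc v)) (label B s') \<le> card (insert x (stored S xs v))"
          using insert_stores[OF Pc vn x(2)] fin by (intro movements_le) auto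
        then show "of_nat (movements (label B (state_at Pc v)) (label B s'))
          \<le> (of_nat (4 * 2 ^ fst z) :: ennreal)"
          using cx by (intro of_nat_mono) simp
      qed
      then show ?thesis by simp
    qed
    have "(\<integral>\<^sup>+ Pc. of_nat (snd Pc) \<partial>measure_pmf ?q') =
        (\<integral>\<^sup>+ Pc. of_nat (snd Pc) + (insert_movements B x (state_at Pc v) + run_cost B z A [])
          \<partial>measure_pmf q)"
      by (simp add: insert_movements_def nn_integral_add run_cost_Nil new_def)
    also have "\<dots> \<le> (\<integral>\<^sup>+ Pc. of_nat (snd Pc) + (of_nat (4 * 2 ^ fst z) + run_cost B z A [])
          \<partial>measure_pmf q)"
      by (rule nn_integral_mono_AE) (use d in \<open>auto simp: AE_measure_pmf_iff intro!: add_mono\<close>)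
    also have "\<dots> = (\<integral>\<^sup>+ Pc. of_nat (snd Pc) \<partial>measure_pmf q) + (of_nat (4 * 2 ^ fst z) + run_cost B z A [])"
      by (simp add: nn_integral_add)
    also have "\<dots> \<le> (\<Sum>v\<in>Cr. ?R S xs v) + (of_nat (4 * 2 ^ fst z) + run_cost B z A [])"
      by (rule add_right_mono[OF cost])
    also have "(\<Sum>v\<in>Cr. ?R S xs v) = (\<Sum>v\<in>Cr. ?R ?S ?xs v)"
      by (rule sum.cong) (use zc in auto)
    also have "\<dots> + (of_nat (4 * 2 ^ fst z) + run_cost B z A []) = (\<Sum>v\<in>?Cr. ?R ?S ?xs v)"
      using finite_created zc by (simp add: algebra_simps)
    finally show "(\<integral>\<^sup>+ Pc. of_nat (snd Pc) \<partial>measure_pmf ?q') \<le> (\<Sum>v\<in>?Cr. ?R ?S ?xs v)" .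
  qed (rule correct)
  then show ?thesis unfolding q' by blast
qed

lemma simulation_step:
  assumes "x \<in> X" "x \<notin> Y" "p x \<in> {1..2 ^ k}"
  shows "\<exists>ns' Cr' S' xs' w'. simulation k X p (insert x Y) ns' Cr' S' xs' w' B
    (bind_pmf q (learned_step B (p x) x))"
proof -
  obtain i where i: "i < length ns" "fits ns (stored S xs) (p x) x (ns ! i)"
    "\<And>Pc. Pc \<in> set_pmf q \<Longrightarrow> target B (fst Pc) (p x) x = i"
    using obtain_target[OF assms(2,3)] by blast
  show ?thesis
  proof (cases "3 * 2 ^ fst (ns ! i) < Suc (card (stored S xs (ns ! i)))")
    case True
    then show ?thesis using simulation_merge[OF i assms(1,2)] by blast
  next
    case False
    then show ?thesis using simulation_append[OF i assms(1,2)] by (meson not_less)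
  qed
qed

end

lemma simulation_inserts:
  assumes "simulation k X p Y ns Cr S xs w B q"
    and "set zs \<subseteq> X" "distinct zs" "set zs \<inter> Y = {}" "\<And>x. x \<in> X \<Longrightarrow> p x \<in> {1..2 ^ k}"
  shows "\<exists>ns' Cr' S' xs' w'. simulation k X p (Y \<union> set zs) ns' Cr' S' xs' w' B
    (bind_pmf q (learned_inserts B p zs))"
  using assms(1-4)
proof (induction zs arbitrary: Y ns Cr S xs w q)
  case Nil
  have "learned_inserts B p [] = return_pmf" by (rule ext) simp
  then have "bind_pmf q (learned_inserts B p []) = q" by (simp only: bind_return_pmf')
  then show ?case using Nil by (metis Un_empty_right list.set(1))
next
  case (Cons x zs)
  have "\<exists>ns' Cr' S' xs' w'. simulation k X p (insert x Y) ns' Cr' S' xs' w' B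
    (bind_pmf q (learned_step B (p x) x))"
    using Cons.prems assms(5) by (intro simulation.simulation_step[OF Cons.prems(1)]) auto
  then obtain ns' Cr' S' xs' w' where
    s: "simulation k X p (insert x Y) ns' Cr' S' xs' w' B (bind_pmf q (learned_step B (p x) x))"
    by blast
  have l: "learned_inserts B p (x # zs) =
    (\<lambda>Pc. bind_pmf (learned_step B (p x) x Pc) (learned_inserts B p zs))"
    by (rule ext) (rule learned_inserts_Cons)
  have "Y \<union> set (x # zs) = insert x Y \<union> set zs" by auto
  moreover have "bind_pmf q (learned_inserts B p (x # zs)) =
      bind_pmf (bind_pmf q (learned_step B (p x) x)) (learned_inserts B p zs)"
    unfolding l by (simp only: bind_assoc_pmf)
  moreover have "\<exists>ns' Cr' S' xs' w'. simulation k X p (insert x Y \<union> set zs) ns' Cr' S' xs' w' B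
    (bind_pmf (bind_pmf q (learned_step B (p x) x)) (learned_inserts B p zs))"
    by (rule Cons.IH[OF s]) (use Cons.prems in auto)
  ultimately show ?case by (simp only:)
qed

lemma learned_empty_shape:
  "P \<in> set_pmf (learned_empty B m) \<Longrightarrow> map fst P = map (Pair 0) [1..<Suc m]"
  by (induction m arbitrary: P) auto

lemma learned_empty_marginal:
  assumes "i \<in> {1..m}"
  shows "map_pmf (\<lambda>P. the (map_of P (0, i))) (learned_empty B m) = Init B 6 {}"
  using assms
proof (induction m)
  case (Suc m)
  have k: "fst ` set P = Pair 0 ` {1..m}" if "P \<in> set_pmf (learned_empty B m)" for P
    using learned_empty_shape[OF that] by (metis atLeastLessThanSuc_atLeastAtMost set_map set_upt)
  have m: "map_of (P @ [((0, Suc m), s)]) (0, i) = (if i = Suc m then Some s else map_of P (0, i))"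
    if "P \<in> set_pmf (learned_empty B m)" for P s
  proof -
    have "map_of P (0, Suc m) = None" using k[OF that] by (auto simp: map_of_eq_None_iff)
    then show ?thesis by (auto simp: map_add_def split: option.splits)
  qed
  have "map_pmf (\<lambda>P. the (map_of P (0, i))) (learned_empty B (Suc m)) =
      bind_pmf (learned_empty B m) (\<lambda>P. bind_pmf (Init B 6 {}) (\<lambda>s.
        return_pmf (if i = Suc m then s else the (map_of P (0, i)))))"
    unfolding learned_empty.simps map_bind_pmf map_return_pmf
    by (intro bind_pmf_cong) (use m in simp_all)
  also have "\<dots> = Init B 6 {}"
  proof (cases "i = Suc m")
    case False
    then show ?thesis using Suc by (simp add: map_pmf_def)
  qed (simp add: bind_return_pmf')
  finally show ?case .
qed simp

lemma simulation_start:
  assumes "list_labeling_array B" "finite X" "card X \<le> 2 ^ k"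
  shows "simulation k X p {} (map (Pair 0) [1..<Suc (2 ^ k)]) (Pair 0 ` {1..2 ^ k}) (\<lambda>_. {}) (\<lambda>_. []) w B
    (map_pmf (\<lambda>P. (P, 0)) (learned_empty B (2 ^ k)))"
proof -
  interpret history k X p "{}" "map (Pair 0) [1..<Suc (2 ^ k)]" "Pair 0 ` {1..2 ^ k}" "\<lambda>_. {}" "\<lambda>_. []" w
    by (rule history_start[OF assms(2,3)])
  show ?thesis
  proof
    fix u :: node assume "u \<in> set (map (Pair 0) [1..<Suc (2 ^ k)])"
    then obtain i where "u = (0, i)" "i \<in> {1..2 ^ k}" by auto
    then show "map_pmf (\<lambda>Pc. state_at Pc u) (map_pmf (\<lambda>P. (P, 0)) (learned_empty B (2 ^ k))) =
      map_pmf fst (lla_run B (6 * 2 ^ fst u) {} [])"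
      using learned_empty_marginal[of i "2 ^ k" B]
      by (simp add: state_at_def pmf.map_comp o_def lla_run_def map_bind_pmf bind_return_pmf')
  next
    fix Pc assume "Pc \<in> set_pmf (map_pmf (\<lambda>P. (P, 0::nat)) (learned_empty B (2 ^ k)))"
    then show "map fst (fst Pc) = map (Pair 0) [1..<Suc (2 ^ k)]"
      using learned_empty_shape by fastforce
  qed (use assms in simp_all)
qed

lemma learned_cost_le:
  assumes "list_labeling_array B" "finite X" "card X \<le> 2 ^ k"
    and "distinct zs" "set zs = X" "\<And>x. x \<in> X \<Longrightarrow> p x \<in> {1..2 ^ k}"
  obtains ns Cr S xs w where "history k X p X ns Cr S xs w"
    "learned_cost B (2 ^ k) p zs \<le> (\<Sum>v\<in>Cr. run_cost B v (S v) (xs v) + of_nat (4 * 2 ^ fst v))"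
proof -
  have "\<exists>ns Cr S xs w. simulation k X p ({} \<union> set zs) ns Cr S xs w B
    (bind_pmf (map_pmf (\<lambda>P. (P, 0)) (learned_empty B (2 ^ k))) (learned_inserts B p zs))"
    by (rule simulation_inserts[OF simulation_start[OF assms(1-3)]]) (use assms in auto)
  then obtain ns Cr S xs w where s: "simulation k X p X ns Cr S xs w B
    (bind_pmf (learned_empty B (2 ^ k)) (\<lambda>P. learned_inserts B p zs (P, 0)))"
    using assms(5) by (auto simp: bind_map_pmf)
  then show ?thesis
    using that[of ns Cr S xs w] simulation.cost[OF s] unfolding learned_cost_def simulation_def by blast
qed

section \<open>Prediction errors\<close>

context history
begin

lemma witness_in_X: "v \<in> Cr \<Longrightarrow> 0 < fst v \<Longrightarrow> w v \<in> X"
  using created_below[of v] stored_subset Y_subset by blast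

lemma card_created_at_height:
  assumes "0 < h"
  shows "card {v \<in> Cr. fst v = h} \<le> card {x \<in> X. far p (rank_in X) (h - 1) x}"
proof (rule card_inj_on_le)
  show "inj_on w {v \<in> Cr. fst v = h}" using witness_inj assms by (auto simp: inj_on_def)
  show "w ` {v \<in> Cr. fst v = h} \<subseteq> {x \<in> X. far p (rank_in X) (h - 1) x}"
    using witness_in_X witness_far assms by auto
  show "finite {x \<in> X. far p (rank_in X) (h - 1) x}" using finite_X by simp
qed

lemma created_sum_le:
  fixes g :: "nat \<Rightarrow> real"
  assumes K: "0 \<le> K" and g: "\<And>h. 0 \<le> g h" and M: "\<And>h. h \<le> J \<Longrightarrow> g h \<le> M"
  shows "(\<Sum>v\<in>Cr. K * 2 ^ fst v + g (fst v) * real (length (xs v)))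
    \<le> K * (real J + 1) * 2 ^ k + M * 2 ^ k
      + (\<Sum>h\<in>{J<..k}. (K + 3 * g h) * 2 ^ h * real (card {x \<in> X. far p (rank_in X) (h - 1) x}))"
proof -
  let ?f = "\<lambda>v. K * 2 ^ fst v + g (fst v) * real (length (xs v))"
  define L where "L = {v \<in> Cr. fst v \<le> J}"
  define H where "H = {v \<in> Cr. J < fst v}"
  have fin: "finite L" "finite H" using finite_created by (auto simp: L_def H_def)
  have len: "real (length (xs v)) \<le> 3 * 2 ^ fst v" if "v \<in> Cr" for v
  proof -
    have "length (xs v) \<le> 3 * 2 ^ fst v" using card_inserted[OF that] by auto
    then have "real (length (xs v)) \<le> real (3 * 2 ^ fst v)" by (rule of_nat_mono)
    then show ?thesis by simp
  qed
  have M0: "0 \<le> M" using g[of 0] M[of 0] by simp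
  have "(\<Sum>v\<in>L. (2::real) ^ fst v) \<le> (\<Sum>v\<in>{v \<in> nodes k. fst v \<le> J}. 2 ^ fst v)"
    by (rule sum_mono2) (use created_nodes finite_nodes in \<open>auto simp: L_def\<close>)
  also have "\<dots> = (\<Sum>h\<in>{..J}. \<Sum>v\<in>{v \<in> {v \<in> nodes k. fst v \<le> J}. fst v = h}. 2 ^ fst v)"
    by (rule sum.group[symmetric]) (use finite_nodes in auto)
  also have "\<dots> \<le> (\<Sum>h\<in>{..J}. 2 ^ k)"
  proof (rule sum_mono)
    fix h assume "h \<in> {..J}"
    then have "{v \<in> {v \<in> nodes k. fst v \<le> J}. fst v = h} = {v \<in> nodes k. fst v = h}" by auto
    then show "(\<Sum>v\<in>{v \<in> {v \<in> nodes k. fst v \<le> J}. fst v = h}. (2::real) ^ fst v) \<le> 2 ^ k"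
      using sum_nodes_at_height by simp
  qed
  finally have L1: "(\<Sum>v\<in>L. (2::real) ^ fst v) \<le> (real J + 1) * 2 ^ k" by (simp add: algebra_simps)
  have "(\<Sum>v\<in>L. real (length (xs v))) \<le> (\<Sum>v\<in>Cr. real (length (xs v)))"
    by (rule sum_mono2) (use finite_created in \<open>auto simp: L_def\<close>)
  also have "\<dots> \<le> real (card Y)" using total_inserted by (simp flip: of_nat_sum)
  also have "\<dots> \<le> real (2 ^ k)"
    using card_mono[OF finite_X Y_subset] card_X by (intro of_nat_mono) simp
  finally have L2: "(\<Sum>v\<in>L. real (length (xs v))) \<le> 2 ^ k" by simp
  have "(\<Sum>v\<in>L. ?f v) \<le> (\<Sum>v\<in>L. K * 2 ^ fst v + M * real (length (xs v)))"
    using M by (intro sum_mono add_left_mono mult_right_mono) (auto simp: L_def)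
  also have "\<dots> = K * (\<Sum>v\<in>L. 2 ^ fst v) + M * (\<Sum>v\<in>L. real (length (xs v)))"
    by (simp add: sum.distrib sum_distrib_left)
  also have "\<dots> \<le> K * ((real J + 1) * 2 ^ k) + M * 2 ^ k"
    using L1 L2 K M0 by (intro add_mono mult_left_mono) auto
  finally have low: "(\<Sum>v\<in>L. ?f v) \<le> K * (real J + 1) * 2 ^ k + M * 2 ^ k" by simp
  have "?f v \<le> (K + 3 * g (fst v)) * 2 ^ fst v" if "v \<in> H" for v
    using mult_left_mono[OF len[of v] g[of "fst v"]] that by (simp add: H_def algebra_simps)
  then have "(\<Sum>v\<in>H. ?f v) \<le> (\<Sum>v\<in>H. (K + 3 * g (fst v)) * 2 ^ fst v)" by (rule sum_mono)
  also have "\<dots> = (\<Sum>h\<in>{J<..k}. \<Sum>v\<in>{v \<in> H. fst v = h}. (K + 3 * g (fst v)) * 2 ^ fst v)"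
    by (rule sum.group[symmetric])
      (use fin created_nodes in \<open>auto simp: H_def nodes_def\<close>)
  also have "\<dots> \<le> (\<Sum>h\<in>{J<..k}. (K + 3 * g h) * 2 ^ h
      * real (card {x \<in> X. far p (rank_in X) (h - 1) x}))"
  proof (rule sum_mono)
    fix h assume h: "h \<in> {J<..k}"
    then have "{v \<in> H. fst v = h} = {v \<in> Cr. fst v = h}" by (auto simp: H_def)
    then have "(\<Sum>v\<in>{v \<in> H. fst v = h}. (K + 3 * g (fst v)) * 2 ^ fst v)
      = (K + 3 * g h) * 2 ^ h * real (card {v \<in> Cr. fst v = h})" by simp
    also have "\<dots> \<le> (K + 3 * g h) * 2 ^ h * real (card {x \<in> X. far p (rank_in X) (h - 1) x})"
      using card_created_at_height[of h] h K g[of h] by (intro mult_left_mono of_nat_mono) auto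
    finally show "(\<Sum>v\<in>{v \<in> H. fst v = h}. (K + 3 * g (fst v)) * 2 ^ fst v) \<le> \<dots>" .
  qed
  finally have high: "(\<Sum>v\<in>H. ?f v) \<le> (\<Sum>h\<in>{J<..k}. (K + 3 * g h) * 2 ^ h
      * real (card {x \<in> X. far p (rank_in X) (h - 1) x}))" .
  have "Cr = L \<union> H" "L \<inter> H = {}" by (auto simp: L_def H_def)
  then have "(\<Sum>v\<in>Cr. ?f v) = (\<Sum>v\<in>L. ?f v) + (\<Sum>v\<in>H. ?f v)"
    using fin by (simp add: sum.union_disjoint)
  then show ?thesis using low high by linarith
qed

end

lemma far_clamped:
  assumes "i < n" and "far (\<lambda>_. clamp_rank n (real i + d)) (\<lambda>_. i) h y"
  shows "2 ^ h / 2 \<le> \<bar>d\<bar>"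
proof -
  let ?z = "real i + d"
  define q where "q = round ?z"
  have q: "of_int q \<le> ?z + 1 / 2" "?z - 1 / 2 \<le> of_int q"
    using of_int_round_le[of ?z] of_int_round_ge[of ?z] by (auto simp: q_def)
  have p: "clamp_rank n ?z = max 1 (min n (nat q))" by (simp add: clamp_rank_def q_def)
  have h1: "(1::real) \<le> 2 ^ h" by simp
  consider "clamp_rank n ?z + 2 ^ h \<le> i" | "i + 2 ^ h < clamp_rank n ?z"
    using assms(2) by (auto simp: far_def)
  then show ?thesis
  proof cases
    case 1
    then have "nat q + 2 ^ h \<le> i" using assms(1) unfolding p by (auto simp: max_def min_def split: if_splits)
    then have "int (nat q + 2 ^ h) \<le> int i" by (simp only: of_nat_le_iff)
    moreover have "int (nat q + 2 ^ h) = int (nat q) + 2 ^ h" by (simp del: int_nat_eq)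
    moreover have "q \<le> int (nat q)" by simp
    ultimately have "q + 2 ^ h \<le> int i" by linarith
    then have "real_of_int (q + 2 ^ h) \<le> real_of_int (int i)" by (simp only: of_int_le_iff)
    then have "real_of_int q + 2 ^ h \<le> real i" by simp
    then show ?thesis using q h1 abs_ge_minus_self[of d] by linarith
  next
    case 2
    have "(1::nat) \<le> 2 ^ h" by simp
    then have "i + 2 ^ h < nat q" using 2 assms(1) unfolding p by (auto simp: max_def min_def split: if_splits)
    then have "int (i + 2 ^ h) < q" by (simp only: zless_nat_eq_int_zless)
    then have "int i + 2 ^ h < q" by simp
    then have "real_of_int (int i + 2 ^ h) < real_of_int q" by (simp only: of_int_less_iff)
    then have "real i + 2 ^ h < real_of_int q" by simp
    then show ?thesis using q h1 abs_ge_self[of d] by linarith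
  qed
qed

lemma card_far_clamped:
  fixes X :: "'a::linorder set"
  assumes X: "finite X" "card X \<le> n" and h: "0 < h"
    and p: "\<And>x. x \<in> X \<Longrightarrow> p x = clamp_rank n (real (rank_in X x) + e x)"
  shows "real (card {x \<in> X. far p (rank_in X) (h - 1) x}) \<le> 16 / 4 ^ h * (\<Sum>x\<in>X. (e x)\<^sup>2)"
proof -
  let ?F = "{x \<in> X. far p (rank_in X) (h - 1) x}"
  have "1 \<le> 16 / 4 ^ h * (e x)\<^sup>2" if x: "x \<in> ?F" for x
  proof -
    have "{y \<in> X. y < x} \<subset> X" using x by auto
    then have "rank_in X x < card X" unfolding rank_in_def by (rule psubset_card_mono[OF X(1)])
    then have "rank_in X x < n" using X(2) by simp
    moreover have "far (\<lambda>_. clamp_rank n (real (rank_in X x) + e x)) (\<lambda>_. rank_in X x) (h - 1) x"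
      using x p[of x] by (simp add: far_def)
    ultimately have "2 ^ (h - 1) / 2 \<le> \<bar>e x\<bar>" by (rule far_clamped)
    moreover have "(2::real) ^ h = 2 * 2 ^ (h - 1)" using h by (cases h) auto
    ultimately have "2 ^ h / 4 \<le> \<bar>e x\<bar>" by simp
    then have "(2 ^ h / 4)\<^sup>2 \<le> \<bar>e x\<bar>\<^sup>2" by (rule power_mono) simp
    moreover have "((2::real) ^ h)\<^sup>2 = 4 ^ h" by (simp add: power2_eq_square flip: power_mult_distrib)
    ultimately show ?thesis by (simp add: power_divide field_simps)
  qed
  then have "(\<Sum>x\<in>?F. 1) \<le> (\<Sum>x\<in>?F. 16 / 4 ^ h * (e x)\<^sup>2)" by (rule sum_mono)
  also have "\<dots> \<le> (\<Sum>x\<in>X. 16 / 4 ^ h * (e x)\<^sup>2)"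
    by (rule sum_mono2) (use X in auto)
  finally show ?thesis by (simp add: sum_distrib_left)
qed

lemma cost_ge_1:
  fixes B :: "('a::linorder, 's) lla"
  assumes B: "list_labeling_array B" and C: "amortized_cost B C" and n: "1 \<le> n"
  shows "1 \<le> C n"
proof -
  obtain c where c: "\<And>n' S xs. 1 \<le> n' \<Longrightarrow> new_elements S xs \<Longrightarrow> card S + length xs \<le> n' \<Longrightarrow>
    (\<integral>\<^sup>+ sc. of_nat (snd sc) \<partial>measure_pmf (lla_run B (2 * n') S xs))
      \<le> ennreal (c * real (card S) + C n' * real (length xs))"
    using C unfolding amortized_cost_def by blast
  fix x :: 'a
  have "1 \<le> snd sc" if sc: "sc \<in> set_pmf (lla_run B (2 * n) {} [x])" for sc
  proof -
    have "sc \<in> set_pmf (lla_run B (2 * n) {} ([] @ [x]))" using sc by simp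
    then obtain sc0 s' where s: "sc0 \<in> set_pmf (lla_run B (2 * n) {} [])"
      "sc = (s', snd sc0 + movements (label B (fst sc0)) (label B s'))"
      unfolding lla_run_snoc by auto
    have "fst sc0 \<in> set_pmf (map_pmf fst (lla_run B (2 * n) {} []))" using s by simp
    then have a: "stores_sorted (2 * n) ({} \<union> set []) (label B (fst sc0))"
      by (intro lla_run_stores[OF B]) (auto simp: new_elements_def)
    have "s' \<in> set_pmf (map_pmf fst (lla_run B (2 * n) {} [x]))" using sc s(2) by force
    then have b: "stores_sorted (2 * n) ({} \<union> set [x]) (label B s')"
      by (rule lla_run_stores[OF B, rotated -1]) (use n in \<open>auto simp: new_elements_def\<close>)
    have "label B (fst sc0) x = None" "x \<in> dom (label B s')"
      using a b by (auto simp: stores_sorted_def)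
    then have "x \<in> {z \<in> dom (label B s'). label B s' z \<noteq> label B (fst sc0) z}" by auto
    moreover have "finite {z \<in> dom (label B s'). label B s' z \<noteq> label B (fst sc0) z}"
      using b by (auto simp: stores_sorted_def)
    ultimately have "0 < movements (label B (fst sc0)) (label B s')"
      unfolding movements_def by (auto simp: card_gt_0_iff)
    then show ?thesis by (simp add: s(2))
  qed
  then have "(\<integral>\<^sup>+ sc. 1 \<partial>measure_pmf (lla_run B (2 * n) {} [x]))
      \<le> (\<integral>\<^sup>+ sc. of_nat (snd sc) \<partial>measure_pmf (lla_run B (2 * n) {} [x]))"
    by (intro nn_integral_mono_AE) (auto simp: AE_measure_pmf_iff one_le_numeral of_nat_mono[of 1, simplified])
  also have "\<dots> \<le> ennreal (c * real (card ({} :: 'a set)) + C n * real (length [x]))"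
    using n by (intro c) (auto simp: new_elements_def)
  finally show ?thesis by simp
qed

lemma run_cost_le:
  fixes B :: "('a::linorder, 's) lla"
  assumes B: "list_labeling_array B"
    and C: "\<And>n' S xs. 1 \<le> n' \<Longrightarrow> new_elements S xs \<Longrightarrow> card S + length xs \<le> n' \<Longrightarrow>
      (\<integral>\<^sup>+ sc. of_nat (snd sc) \<partial>measure_pmf (lla_run B (2 * n') S xs))
        \<le> ennreal (c * real (card S) + C n' * real (length xs))"
    and c: "1 \<le> c" and S: "new_elements S xs" "card S < 4 * 2 ^ fst v"
    and xs: "xs = [] \<or> card S + length xs \<le> 3 * 2 ^ fst v"
  shows "run_cost B v S xs \<le> ennreal (c * real (card S) + C (3 * 2 ^ fst v) * real (length xs))"
proof (cases "card S + length xs \<le> 3 * 2 ^ fst v")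
  case True
  then show ?thesis
    using C[of "3 * 2 ^ fst v" S xs] S(1) by (simp add: run_cost_def)
next
  case False
  then have e: "xs = []" using xs by blast
  have f: "finite S" using S(1) by (simp add: new_elements_def)
  have "run_cost B v S [] \<le> (\<integral>\<^sup>+ s. of_nat (card S) \<partial>measure_pmf (Init B (6 * 2 ^ fst v) S))"
    unfolding run_cost_Nil
  proof (rule nn_integral_mono_AE, unfold AE_measure_pmf_iff, intro ballI of_nat_mono)
    fix s assume "s \<in> set_pmf (Init B (6 * 2 ^ fst v) S)"
    then have "s \<in> set_pmf (map_pmf fst (lla_run B (6 * 2 ^ fst v) S []))"
      by (force simp: lla_run_def)
    then have "stores_sorted (6 * 2 ^ fst v) (S \<union> set []) (label B s)"
      by (rule lla_run_stores[OF B, rotated -1]) (use S e in auto)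
    then show "movements Map.empty (label B s) \<le> card S" using movements_le f by fastforce
  qed
  also have "\<dots> = ennreal (real (card S))" by (simp add: ennreal_of_nat_eq_real_of_nat)
  also have "\<dots> \<le> ennreal (c * real (card S))"
    using c by (intro ennreal_leI) (simp add: mult_le_cancel_right1)
  finally show ?thesis using e by simp
qed

lemma learned_cost_le_errors:
  fixes B :: "('a::linorder, 's) lla"
  assumes B: "list_labeling_array B"
    and C: "\<And>n' S xs. 1 \<le> n' \<Longrightarrow> new_elements S xs \<Longrightarrow> card S + length xs \<le> n' \<Longrightarrow>
      (\<integral>\<^sup>+ sc. of_nat (snd sc) \<partial>measure_pmf (lla_run B (2 * n') S xs))
        \<le> ennreal (c * real (card S) + C n' * real (length xs))"
    and c: "1 \<le> c" and C0: "\<And>n. 1 \<le> n \<Longrightarrow> 0 \<le> C n"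
    and M: "\<And>h. h \<le> J \<Longrightarrow> C (3 * 2 ^ h) \<le> M"
    and X: "finite X" "card X \<le> 2 ^ k" "distinct zs" "set zs = X"
    and p: "\<And>x. x \<in> X \<Longrightarrow> p x = clamp_rank (2 ^ k) (real (rank_in X x) + e x)"
  shows "learned_cost B (2 ^ k) p zs \<le> ennreal ((4 * c + 4) * (real J + 1) * 2 ^ k + M * 2 ^ k
    + 16 * (\<Sum>h\<in>{J<..k}. (4 * c + 4 + 3 * C (3 * 2 ^ h)) / 2 ^ h) * (\<Sum>x\<in>X. (e x)\<^sup>2))"
proof -
  have pk: "p x \<in> {1..2 ^ k}" if "x \<in> X" for x
    using p[OF that] by (auto simp: clamp_rank_def)
  obtain ns Cr S xs w where H: "history k X p X ns Cr S xs w"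
    and le: "learned_cost B (2 ^ k) p zs \<le> (\<Sum>v\<in>Cr. run_cost B v (S v) (xs v) + of_nat (4 * 2 ^ fst v))"
    by (rule learned_cost_le[OF B X pk])
  interpret history k X p X ns Cr S xs w by (rule H)
  let ?K = "4 * c + 4" and ?g = "\<lambda>h. C (3 * 2 ^ h)"
  have g0: "0 \<le> ?g h" for h using C0[of "3 * 2 ^ h"] by simp
  have "run_cost B v (S v) (xs v) + of_nat (4 * 2 ^ fst v)
    \<le> ennreal (?K * 2 ^ fst v + ?g (fst v) * real (length (xs v)))" if v: "v \<in> Cr" for v
  proof -
    have "run_cost B v (S v) (xs v) + of_nat (4 * 2 ^ fst v)
      \<le> ennreal (c * real (card (S v)) + ?g (fst v) * real (length (xs v))) + ennreal (4 * 2 ^ fst v)"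
      using run_cost_le[OF B C c inserted_new[OF v] card_init[OF v] card_inserted[OF v]]
      by (intro add_mono) (auto simp: ennreal_of_nat_eq_real_of_nat)
    also have "\<dots> = ennreal (c * real (card (S v)) + ?g (fst v) * real (length (xs v)) + 4 * 2 ^ fst v)"
      using c g0 by (intro ennreal_plus[symmetric]) auto
    also have "\<dots> \<le> ennreal (?K * 2 ^ fst v + ?g (fst v) * real (length (xs v)))"
    proof (rule ennreal_leI)
      have "real (card (S v)) \<le> real (4 * 2 ^ fst v)"
        using card_init[OF v] by (intro of_nat_mono) simp
      then have "c * real (card (S v)) \<le> c * (4 * 2 ^ fst v)" using c by (intro mult_left_mono) auto
      then show "c * real (card (S v)) + ?g (fst v) * real (length (xs v)) + 4 * 2 ^ fst v
        \<le> ?K * 2 ^ fst v + ?g (fst v) * real (length (xs v))" by (simp add: algebra_simps)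
    qed
    finally show ?thesis .
  qed
  then have "(\<Sum>v\<in>Cr. run_cost B v (S v) (xs v) + of_nat (4 * 2 ^ fst v))
    \<le> (\<Sum>v\<in>Cr. ennreal (?K * 2 ^ fst v + ?g (fst v) * real (length (xs v))))"
    by (rule sum_mono)
  also have "\<dots> = ennreal (\<Sum>v\<in>Cr. ?K * 2 ^ fst v + ?g (fst v) * real (length (xs v)))"
    using c g0 by (intro sum_ennreal) auto
  also have "\<dots> \<le> ennreal (?K * (real J + 1) * 2 ^ k + M * 2 ^ k
    + 16 * (\<Sum>h\<in>{J<..k}. (?K + 3 * ?g h) / 2 ^ h) * (\<Sum>x\<in>X. (e x)\<^sup>2))"
  proof (rule ennreal_leI)
    define Q where "Q = (\<Sum>x\<in>X. (e x)\<^sup>2)"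
    have "(\<Sum>v\<in>Cr. ?K * 2 ^ fst v + ?g (fst v) * real (length (xs v)))
      \<le> ?K * (real J + 1) * 2 ^ k + M * 2 ^ k
      + (\<Sum>h\<in>{J<..k}. (?K + 3 * ?g h) * 2 ^ h * real (card {x \<in> X. far p (rank_in X) (h - 1) x}))"
      by (rule created_sum_le) (use c g0 M in auto)
    moreover have "(\<Sum>h\<in>{J<..k}. (?K + 3 * ?g h) * 2 ^ h * real (card {x \<in> X. far p (rank_in X) (h - 1) x}))
      \<le> (\<Sum>h\<in>{J<..k}. 16 * ((?K + 3 * ?g h) / 2 ^ h) * Q)"
    proof (rule sum_mono)
      fix h assume "h \<in> {J<..k}"
      then have "real (card {x \<in> X. far p (rank_in X) (h - 1) x}) \<le> 16 / 4 ^ h * Q"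
        unfolding Q_def using X p by (intro card_far_clamped[where n = "2 ^ k"]) auto
      then have "(?K + 3 * ?g h) * 2 ^ h * real (card {x \<in> X. far p (rank_in X) (h - 1) x})
        \<le> (?K + 3 * ?g h) * 2 ^ h * (16 / 4 ^ h * Q)"
        using c g0[of h] by (intro mult_left_mono) auto
      also have "\<dots> = 16 * ((?K + 3 * ?g h) / 2 ^ h) * Q"
      proof -
        have "(4::real) ^ h = 2 ^ h * 2 ^ h" by (simp flip: power_mult_distrib)
        then show ?thesis by simp
      qed
      finally show "(?K + 3 * ?g h) * 2 ^ h * real (card {x \<in> X. far p (rank_in X) (h - 1) x}) \<le> \<dots>" .
    qed
    moreover have "(\<Sum>h\<in>{J<..k}. 16 * ((?K + 3 * ?g h) / 2 ^ h) * Q)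
      = 16 * (\<Sum>h\<in>{J<..k}. (?K + 3 * ?g h) / 2 ^ h) * Q"
      by (simp only: sum_distrib_left sum_distrib_right)
    ultimately show "(\<Sum>v\<in>Cr. ?K * 2 ^ fst v + ?g (fst v) * real (length (xs v)))
      \<le> ?K * (real J + 1) * 2 ^ k + M * 2 ^ k + 16 * (\<Sum>h\<in>{J<..k}. (?K + 3 * ?g h) / 2 ^ h) * (\<Sum>x\<in>X. (e x)\<^sup>2)"
      unfolding Q_def[symmetric] by linarith
  qed
  finally show ?thesis using le by (rule order_trans[rotated])
qed

lemma second_moment:
  assumes "has_mean_variance D \<mu> v"
  shows "(\<integral>\<^sup>+ y. ennreal (y\<^sup>2) \<partial>D) = ennreal (\<mu>\<^sup>2 + v)"
proof -
  interpret prob_space D using assms by (simp add: has_mean_variance_def)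
  have i: "integrable D (\<lambda>x. x)" "integrable D (\<lambda>x. x\<^sup>2)" "expectation (\<lambda>x. x) = \<mu>" "variance (\<lambda>x. x) = v"
    using assms by (auto simp: has_mean_variance_def)
  have "expectation (\<lambda>x. x\<^sup>2) = \<mu>\<^sup>2 + v" using variance_eq[OF i(1,2)] i(3,4) by simp
  then show ?thesis using nn_integral_eq_integral[OF i(2)] by simp
qed

lemma nn_integral_sum_squares:
  assumes D: "has_mean_variance D \<mu> v" and X: "finite X" and "0 \<le> a" "0 \<le> b"
  shows "(\<integral>\<^sup>+ e. ennreal (a + b * (\<Sum>x\<in>X. (e x)\<^sup>2)) \<partial>(PiM X (\<lambda>_. D)))
    = ennreal (a + b * (real (card X) * (\<mu>\<^sup>2 + v)))"
proof -
  have pD: "prob_space D" and sD: "sets D = sets borel"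
    using D by (auto simp: has_mean_variance_def)
  interpret P: prob_space "PiM X (\<lambda>_. D)" by (rule prob_space_PiM) (rule pD)
  have v: "0 \<le> \<mu>\<^sup>2 + v"
    using D by (auto simp: has_mean_variance_def prob_space.variance_positive[OF pD])
  have id: "(\<lambda>y. y) \<in> borel_measurable D" using sD by (simp cong: measurable_cong_sets)
  have m: "(\<lambda>e. e x) \<in> borel_measurable (PiM X (\<lambda>_. D))" if "x \<in> X" for x
    using measurable_compose[OF measurable_component_singleton[OF that] id] .
  have one: "(\<integral>\<^sup>+ e. ennreal ((e x)\<^sup>2) \<partial>(PiM X (\<lambda>_. D))) = ennreal (\<mu>\<^sup>2 + v)" if x: "x \<in> X" for x
  proof -
    have "(\<integral>\<^sup>+ e. ennreal ((e x)\<^sup>2) \<partial>(PiM X (\<lambda>_. D)))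
        = (\<integral>\<^sup>+ y. ennreal (y\<^sup>2) \<partial>(distr (PiM X (\<lambda>_. D)) D (\<lambda>e. e x)))"
      using x id by (intro nn_integral_distr[symmetric]) auto
    also have "\<dots> = (\<integral>\<^sup>+ y. ennreal (y\<^sup>2) \<partial>D)" using distr_PiM_component[of X "\<lambda>_. D"] pD x by simp
    finally show ?thesis using second_moment[OF D] by simp
  qed
  have "(\<integral>\<^sup>+ e. ennreal (a + b * (\<Sum>x\<in>X. (e x)\<^sup>2)) \<partial>(PiM X (\<lambda>_. D)))
      = (\<integral>\<^sup>+ e. ennreal a + ennreal b * (\<Sum>x\<in>X. ennreal ((e x)\<^sup>2)) \<partial>(PiM X (\<lambda>_. D)))"
    using assms(3,4) by (simp add: ennreal_plus sum_nonneg ennreal_mult sum_ennreal)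
  also have "\<dots> = ennreal a + ennreal b * (\<Sum>x\<in>X. \<integral>\<^sup>+ e. ennreal ((e x)\<^sup>2) \<partial>(PiM X (\<lambda>_. D)))"
    using m by (simp add: nn_integral_add nn_integral_cmult nn_integral_sum P.emeasure_space_1
        del: sum_ennreal)
  also have "\<dots> = ennreal a + ennreal b * (\<Sum>x\<in>X. ennreal (\<mu>\<^sup>2 + v))"
    using one by simp
  also have "\<dots> = ennreal (a + b * (real (card X) * (\<mu>\<^sup>2 + v)))"
  proof -
    have "(\<Sum>x\<in>X. ennreal (\<mu>\<^sup>2 + v)) = ennreal (real (card X) * (\<mu>\<^sup>2 + v))"
      using v by (subst sum_ennreal) auto
    then show ?thesis using assms(3,4) v by (simp add: ennreal_plus ennreal_mult)
  qed
  finally show ?thesis .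
qed

lemma admissible_bounds:
  assumes C: "admissible C" and C1: "\<And>n. 1 \<le> n \<Longrightarrow> 1 \<le> C n"
  obtains a b d where "0 \<le> a" "0 \<le> b" "0 \<le> d"
    "\<forall>i\<ge>1. \<forall>j. i < 2 * j \<longrightarrow> C i \<le> d * C j"
    "\<forall>J. \<forall>h\<le>J. C (3 * 2 ^ h) \<le> a * C (2 ^ J)"
    "\<forall>J. real J + 1 \<le> b * C (2 ^ J)"
    "\<forall>J k. (\<Sum>h\<in>{J<..k}. C (2 ^ h) / 2 ^ h) \<le> a * C (2 ^ J) / 2 ^ J"
proof -
  have "\<exists>d. \<forall>i\<ge>1. \<forall>j. i < 2 * j \<longrightarrow> C i \<le> d * C j"
    using C unfolding admissible_def by (elim conjE)
  then obtain d where d: "\<And>i j. 1 \<le> i \<Longrightarrow> i < 2 * j \<Longrightarrow> C i \<le> d * C j" by metis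
  have C2: "1 \<le> C (2 ^ J)" for J using C1[of "2 ^ J"] by simp
  have d1: "1 \<le> d" using d[of 1 1] C1[of 1] by (simp add: mult_le_cancel_right1)
  have "\<exists>s. \<forall>j. summable (\<lambda>i. C (2 ^ (j + Suc i)) / 2 ^ Suc i) \<and>
    (\<Sum>i. C (2 ^ (j + Suc i)) / 2 ^ Suc i) \<le> s * C (2 ^ j)"
    using C unfolding admissible_def by (elim conjE)
  then obtain s where s: "\<And>j. summable (\<lambda>i. C (2 ^ (j + Suc i)) / 2 ^ Suc i)"
    "\<And>j. (\<Sum>i. C (2 ^ (j + Suc i)) / 2 ^ Suc i) \<le> s * C (2 ^ j)" by metis
  have t0: "0 \<le> C (2 ^ (j + Suc i)) / 2 ^ Suc i" for i j
    using C2[of "j + Suc i"] by (intro divide_nonneg_nonneg) auto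
  have s0: "0 \<le> s"
    using order_trans[OF suminf_nonneg[OF s(1)[of 0] t0] s(2)[of 0]] C2[of 0]
    by (simp add: zero_le_mult_iff)
  have part: "(\<Sum>i<m. C (2 ^ (j + Suc i)) / 2 ^ Suc i) \<le> s * C (2 ^ j)" for m j
    using sum_le_suminf[OF s(1), of "{..<m}" j] t0 s(2)[of j] by fastforce
  have dbl: "C (2 ^ Suc j) \<le> 2 * s * C (2 ^ j)" for j
    using part[of j 1] by simp
  obtain c where c: "0 < c" "eventually (\<lambda>n. c * norm (ln (real n)) \<le> norm (C n)) at_top"
    using C unfolding admissible_def by (auto elim: landau_omega.bigE)
  then obtain N where N: "\<And>n. N \<le> n \<Longrightarrow> c * norm (ln (real n)) \<le> norm (C n)"
    unfolding eventually_at_top_linorder by blast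
  define a where "a = max s (2 * s * d)"
  define b where "b = 1 / (c * ln 2) + real N + 1"
  have cl: "0 < c * ln 2" using c by simp
  show ?thesis
  proof
    show "0 \<le> a" "0 \<le> b" "0 \<le> d" using s0 cl d1 by (auto simp: a_def b_def)
    show "\<forall>i\<ge>1. \<forall>j. i < 2 * j \<longrightarrow> C i \<le> d * C j" using d by blast
    show "\<forall>J. \<forall>h\<le>J. C (3 * 2 ^ h) \<le> a * C (2 ^ J)"
    proof (intro allI impI)
      fix J h :: nat assume that: "h \<le> J"
      have "(2::nat) ^ h \<le> 2 ^ J" using that by (intro power_increasing) auto
      moreover have "(0::nat) < 2 ^ J" by simp
      ultimately have "(3::nat) * 2 ^ h < 2 * 2 ^ Suc J" unfolding power_Suc by linarith
      then have "C (3 * 2 ^ h) \<le> d * C (2 ^ Suc J)" by (intro d) auto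
      also have "\<dots> \<le> d * (2 * s * C (2 ^ J))" using dbl d1 by (intro mult_left_mono) auto
      also have "\<dots> \<le> a * C (2 ^ J)"
        using mult_right_mono[of "2 * s * d" a "C (2 ^ J)"] C2[of J] by (simp add: a_def mult_ac)
      finally show "C (3 * 2 ^ h) \<le> a * C (2 ^ J)" .
    qed
    show "\<forall>J. real J + 1 \<le> b * C (2 ^ J)"
    proof
      fix J
      have "real J \<le> (1 / (c * ln 2) + real N) * C (2 ^ J)"
      proof (cases "N \<le> 2 ^ J")
        case True
        have "c * (real J * ln 2) \<le> C (2 ^ J)"
          using N[OF True] C2[of J] by (simp add: ln_realpow)
        then have "real J \<le> 1 / (c * ln 2) * C (2 ^ J)" using c by (simp add: field_simps)
        then show ?thesis using C2[of J] by (simp add: distrib_right add_increasing2)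
      next
        case False
        then have "J \<le> N" using less_exp[of J] by linarith
        then have "real J \<le> real N * C (2 ^ J)"
          using mult_mono[of "real J" "real N" 1 "C (2 ^ J)"] C2[of J] by simp
        moreover have "0 \<le> 1 / (c * ln 2) * C (2 ^ J)" using cl C2[of J] by simp
        ultimately show ?thesis by (simp only: distrib_right)
      qed
      then show "real J + 1 \<le> b * C (2 ^ J)" using C2[of J] by (simp add: b_def distrib_right)
    qed
    show "\<forall>J k. (\<Sum>h\<in>{J<..k}. C (2 ^ h) / 2 ^ h) \<le> a * C (2 ^ J) / 2 ^ J"
    proof (intro allI)
      fix J k
      have "(\<Sum>h\<in>{J<..k}. C (2 ^ h) / 2 ^ h) = (\<Sum>i<k - J. C (2 ^ (J + Suc i)) / 2 ^ (J + Suc i))"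
        by (rule sum.reindex_bij_witness[of _ "\<lambda>i. J + Suc i" "\<lambda>h. h - Suc J"]) auto
      also have "\<dots> = (\<Sum>i<k - J. C (2 ^ (J + Suc i)) / 2 ^ Suc i) / 2 ^ J"
        by (simp add: sum_divide_distrib power_add mult_ac)
      also have "\<dots> \<le> (s * C (2 ^ J)) / 2 ^ J"
        using part by (intro divide_right_mono) auto
      also have "\<dots> \<le> (a * C (2 ^ J)) / 2 ^ J"
        using C2[of J] by (intro divide_right_mono mult_right_mono) (auto simp: a_def)
      finally show "(\<Sum>h\<in>{J<..k}. C (2 ^ h) / 2 ^ h) \<le> a * C (2 ^ J) / 2 ^ J" by simp
    qed
  qed
qed

lemma power_two_between:
  assumes "1 \<le> q"
  obtains J where "q \<le> 2 ^ J" "2 ^ J < 2 * (q::nat)"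
proof -
  define J where "J = (LEAST J. q \<le> 2 ^ J)"
  have le: "q \<le> 2 ^ J" unfolding J_def by (rule LeastI[of _ q]) (simp add: less_imp_le)
  moreover have "2 ^ J < 2 * q"
  proof (cases J)
    case (Suc j)
    then have "\<not> q \<le> 2 ^ j" using not_less_Least[of j "\<lambda>J. q \<le> 2 ^ J"] by (simp add: J_def)
    then show ?thesis using Suc by simp
  qed (use assms in simp)
  ultimately show ?thesis using that by blast
qed

theorem theorem3:
  fixes B :: "('a::linorder, 's) lla" and C :: "nat \<Rightarrow> real"
  assumes "list_labeling_array B" and "amortized_cost B C" and "admissible C"
  shows "\<exists>K. \<forall>(n::nat) (X::'a set) (D::real measure) (\<mu>::real) (s::real) adversary.
     (\<exists>k. n = 2 ^ k) \<and> finite X \<and> card X \<le> n \<and>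
     has_mean_variance D \<mu> (s\<^sup>2) \<and> adversary \<in> adversaries X \<longrightarrow>
     (\<integral>\<^sup>+ e. learned_cost B n (\<lambda>x. clamp_rank n (predicted_rank X e x)) (adversary (predicted_rank X e))
        \<partial>(PiM X (\<lambda>_. D)))
       \<le> ennreal (K * real n * cost_at C ((\<bar>\<mu>\<bar> + s\<^sup>2)\<^sup>2))"
proof -
  have C1: "1 \<le> C n" if "1 \<le> n" for n by (rule cost_ge_1[OF assms(1,2) that])
  obtain c0 where c0: "\<And>n' S xs. 1 \<le> n' \<Longrightarrow> new_elements S xs \<Longrightarrow> card S + length xs \<le> n' \<Longrightarrow>
    (\<integral>\<^sup>+ sc. of_nat (snd sc) \<partial>measure_pmf (lla_run B (2 * n') S xs))
      \<le> ennreal (c0 * real (card S) + C n' * real (length xs))"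
    using assms(2) unfolding amortized_cost_def by blast
  define c where "c = max 1 c0"
  have c1: "1 \<le> c" by (simp add: c_def)
  have c: "(\<integral>\<^sup>+ sc. of_nat (snd sc) \<partial>measure_pmf (lla_run B (2 * n') S xs))
      \<le> ennreal (c * real (card S) + C n' * real (length xs))"
    if "1 \<le> n'" "new_elements S xs" "card S + length xs \<le> n'" for n' S xs
    by (rule order_trans[OF c0[OF that]]) (auto intro!: ennreal_leI mult_right_mono simp: c_def)
  obtain a b d where abd: "0 \<le> a" "0 \<le> b" "0 \<le> d"
    and bounds: "\<forall>i\<ge>1. \<forall>j. i < 2 * j \<longrightarrow> C i \<le> d * C j"
    "\<forall>J. \<forall>h\<le>J. C (3 * 2 ^ h) \<le> a * C (2 ^ J)"
    "\<forall>J. real J + 1 \<le> b * C (2 ^ J)"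
    "\<forall>J k. (\<Sum>h\<in>{J<..k}. C (2 ^ h) / 2 ^ h) \<le> a * C (2 ^ J) / 2 ^ J"
    by (rule admissible_bounds[OF assms(3) C1])
  note d = bounds(1)[rule_format] and a = bounds(2)[rule_format]
    and b = bounds(3)[rule_format] and tail = bounds(4)[rule_format]
  define K0 where "K0 = 4 * c + 4"
  define K1 where "K1 = K0 * b + a + 32 * (K0 + 3 * a) * a"
  have K0: "0 \<le> K0" using c1 by (simp add: K0_def)
  have K1: "0 \<le> K1" using K0 abd by (simp add: K1_def)
  have main: "(\<integral>\<^sup>+ e. learned_cost B n (\<lambda>x. clamp_rank n (predicted_rank X e x)) (adversary (predicted_rank X e))
        \<partial>(PiM X (\<lambda>_. D))) \<le> ennreal (K1 * d * real n * cost_at C ((\<bar>\<mu>\<bar> + s\<^sup>2)\<^sup>2))"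
    if n: "n = 2 ^ k" and X: "finite X" "card X \<le> n" and D: "has_mean_variance D \<mu> (s\<^sup>2)"
      and adv: "adversary \<in> adversaries X"
    for n k :: nat and X :: "'a set" and D :: "real measure" and \<mu> s :: real and adversary
  proof -
    define y where "y = (\<bar>\<mu>\<bar> + s\<^sup>2)\<^sup>2"
    define q where "q = max 1 (nat \<lceil>y\<rceil>)"
    obtain J where J: "q \<le> 2 ^ J" "2 ^ J < 2 * q" using power_two_between[of q] by (auto simp: q_def)
    define T where "T = C (2 ^ J)"
    have T1: "1 \<le> T" unfolding T_def by (rule C1) simp
    have yq: "y \<le> real q" "1 \<le> real q" unfolding q_def by linarith+
    have moment: "\<mu>\<^sup>2 + s\<^sup>2 \<le> 2 * 2 ^ J"
    proof -
      have "y = \<mu>\<^sup>2 + 2 * \<bar>\<mu>\<bar> * s\<^sup>2 + s\<^sup>2 * s\<^sup>2" by (simp add: y_def power2_sum power2_eq_square[of "s\<^sup>2"])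
      moreover have "0 \<le> 2 * \<bar>\<mu>\<bar> * s\<^sup>2" by simp
      moreover have "s\<^sup>2 \<le> 1 + s\<^sup>2 * s\<^sup>2"
      proof -
        have "0 \<le> (s\<^sup>2 - 1)\<^sup>2" by simp
        then have "2 * s\<^sup>2 \<le> 1 + s\<^sup>2 * s\<^sup>2" by (simp add: power2_diff power2_eq_square[of "s\<^sup>2"])
        moreover have "0 \<le> s\<^sup>2" by simp
        ultimately show ?thesis by linarith
      qed
      moreover have "real q \<le> 2 ^ J" using of_nat_mono[OF J(1), where 'a = real] by simp
      ultimately show ?thesis using yq by linarith
    qed
    define H where "H = 16 * (\<Sum>h\<in>{J<..k}. (K0 + 3 * C (3 * 2 ^ h)) / 2 ^ h)"
    have C30: "0 \<le> C (3 * 2 ^ h)" for h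
    proof -
      have "1 \<le> C (3 * 2 ^ h)" by (rule C1) simp
      then show ?thesis by simp
    qed
    have H0: "0 \<le> H"
      unfolding H_def using K0 C30
      by (intro mult_nonneg_nonneg sum_nonneg divide_nonneg_nonneg add_nonneg_nonneg) auto
    have H: "H \<le> 16 * (K0 + 3 * a) * (a * T / 2 ^ J)"
    proof -
      have "(K0 + 3 * C (3 * 2 ^ h)) / 2 ^ h \<le> (K0 + 3 * a) * (C (2 ^ h) / 2 ^ h)" for h
      proof -
        have "K0 * 1 \<le> K0 * C (2 ^ h)" using K0 C1[of "2 ^ h"] by (intro mult_left_mono) auto
        then have "K0 + 3 * C (3 * 2 ^ h) \<le> (K0 + 3 * a) * C (2 ^ h)"
          using a[of h h] by (simp add: algebra_simps)
        then have "(K0 + 3 * C (3 * 2 ^ h)) / 2 ^ h \<le> ((K0 + 3 * a) * C (2 ^ h)) / 2 ^ h"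
          by (rule divide_right_mono) simp
        then show ?thesis by simp
      qed
      then have "H \<le> 16 * ((K0 + 3 * a) * (\<Sum>h\<in>{J<..k}. C (2 ^ h) / 2 ^ h))"
        unfolding H_def sum_distrib_left by (intro sum_mono mult_left_mono) auto
      also have "\<dots> \<le> 16 * ((K0 + 3 * a) * (a * T / 2 ^ J))"
        unfolding T_def using tail K0 abd by (intro mult_left_mono) auto
      finally show ?thesis by (simp only: mult.assoc)
    qed
    let ?A = "K0 * (real J + 1) * 2 ^ k + a * T * 2 ^ k"
    have A0: "0 \<le> ?A" using K0 abd T1 by (intro add_nonneg_nonneg mult_nonneg_nonneg) auto
    have "(\<integral>\<^sup>+ e. learned_cost B n (\<lambda>x. clamp_rank n (predicted_rank X e x)) (adversary (predicted_rank X e))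
        \<partial>(PiM X (\<lambda>_. D))) \<le> (\<integral>\<^sup>+ e. ennreal (?A + H * (\<Sum>x\<in>X. (e x)\<^sup>2)) \<partial>(PiM X (\<lambda>_. D)))"
    proof (rule nn_integral_mono)
      fix e :: "'a \<Rightarrow> real"
      have "predicted_rank X e \<in> space (PiM X (\<lambda>_. borel))"
        by (simp add: space_PiM predicted_rank_def)
      then have "adversary (predicted_rank X e) \<in> {xs. distinct xs \<and> set xs = X}"
        using measurable_space[of adversary] adv unfolding adversaries_def by fastforce
      then have zs: "distinct (adversary (predicted_rank X e))" "set (adversary (predicted_rank X e)) = X"
        by auto
      show "learned_cost B n (\<lambda>x. clamp_rank n (predicted_rank X e x)) (adversary (predicted_rank X e))
        \<le> ennreal (?A + H * (\<Sum>x\<in>X. (e x)\<^sup>2))"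
        unfolding n H_def K0_def
      proof (rule learned_cost_le_errors[OF assms(1) c c1])
        show "0 \<le> C m" if "1 \<le> m" for m using C1[OF that] by linarith
        show "C (3 * 2 ^ h) \<le> a * T" if "h \<le> J" for h using a[OF that] by (simp add: T_def)
      qed (use X n zs in \<open>auto simp: predicted_rank_def\<close>)
    qed
    also have "\<dots> = ennreal (?A + H * (real (card X) * (\<mu>\<^sup>2 + s\<^sup>2)))"
      by (rule nn_integral_sum_squares[OF D X(1) A0 H0])
    also have "\<dots> \<le> ennreal (K1 * d * real n * cost_at C y)"
    proof (rule ennreal_leI)
      have Tq: "T \<le> d * C q" unfolding T_def by (rule d[OF _ J(2)]) simp
      have cX: "real (card X) \<le> 2 ^ k" using of_nat_mono[OF X(2), where 'a = real] n by simp
      have "?A \<le> K0 * (b * T) * 2 ^ k + a * T * 2 ^ k"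
        using b[of J] K0 by (intro add_right_mono mult_right_mono mult_left_mono) (auto simp: T_def)
      moreover have "H * (real (card X) * (\<mu>\<^sup>2 + s\<^sup>2))
        \<le> (16 * (K0 + 3 * a) * (a * T / 2 ^ J)) * (2 ^ k * (2 * 2 ^ J))"
        using H cX moment K0 abd T1 by (intro mult_mono mult_nonneg_nonneg) auto
      then have "H * (real (card X) * (\<mu>\<^sup>2 + s\<^sup>2)) \<le> 32 * (K0 + 3 * a) * a * T * 2 ^ k"
        by (simp add: algebra_simps)
      ultimately have "?A + H * (real (card X) * (\<mu>\<^sup>2 + s\<^sup>2)) \<le> K1 * 2 ^ k * T"
        by (simp add: K1_def algebra_simps)
      also have "\<dots> \<le> K1 * 2 ^ k * (d * C q)" using Tq K1 by (intro mult_left_mono) auto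
      also have "\<dots> = K1 * d * real n * cost_at C y" by (simp add: cost_at_def q_def n)
      finally show "?A + H * (real (card X) * (\<mu>\<^sup>2 + s\<^sup>2)) \<le> K1 * d * real n * cost_at C y" .
    qed
    finally show ?thesis unfolding y_def .
  qed
  show ?thesis by (rule exI[of _ "K1 * d"]) (use main in blast)
qed

end
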